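(* There exists $L_0>0$ such that for every $L\ge L_0$ the following holds. Let $f\in L^2(\mathbb{T}_L)$ with $\|f\|_{L^2(\mathbb{T}_L)}=1$ be a weak solution of $\omega f=Q(f,f,f)$ on $\mathbb{T}_L$ with $\omega=\omega_1(L)$, i.e. $$\omega_1(L)\,\langle g,f\rangle=\mathcal{Q}(g,f,f,f)\qquad\text{for all } g\in L^2(\mathbb{T}_L).$$ Then the Fourier modes of $f$ decay exponentially: there exist constants $c>0$ and $C>0$ such that $$|\hat f(k)|\le C e^{-c|k|}\qquad\text{for all }k\in\mathbb{Z}.$$ In particular, every such solution $f$ is (real-)analytic.
   Context: For $L>0$, $\mathbb{T}_L=\mathbb{R}/(L\mathbb{Z})$, $\langle f,g\rangle=\int_{\mathbb{T}_L}\overline{f}g\,dx$ and $\|f\|_{L^2(\mathbb{T}_L)}^2=\langle f,f\rangle$. Let $e_L(x)=L^{-1/2}e^{2\pi i x/L}$ and, for $f\in L^2(\mathbb{T}_L)$ and $k\in\mathbb{Z}$, $\hat f(k)=\int_{\mathbb{T}_L}f(x)e_L(-kx)\,dx$. $T_r=e^{ir\partial_x^2}$ is the free Schrödinger propagator, $\widehat{T_rf}(k)=e^{-4\pi^2ik^2r/L^2}\hat f(k)$. Define $Q(f,g,h)=\int_0^1T_r^{-1}\big(T_rf\,\overline{T_rg}\,T_rh\big)\,dr$ and $$\mathcal{Q}(f_1,f_2,f_3,f_4)=\int_0^1\int_{\mathbb{T}_L}\overline{T_rf_1}\,T_rf_2\,\overline{T_rf_3}\,T_rf_4\,dx\,dr,\qquad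 \omega_1(L)=\max_{\|f\|_{L^2(\mathbb{T}_L)}=1}\mathcal{Q}(f,f,f,f).$$ The constants $c$ and $C$ may depend on $L$ and on $f$. *)

theory Defs
  imports "HOL-Analysis.Analysis"
begin

text \<open>
  Functions on the torus \<open>\<real>/(L\<int>)\<close> are rendered as \<open>L\<close>-periodic functions on the real line; integrals
  over the torus are Lebesgue integrals over the period \<open>{0..L}\<close>.  Elements of \<open>L\<^sup>2\<close> are functions,
  not equivalence classes; everything below depends on them only up to null sets.
\<close>

definition periodic :: "real \<Rightarrow> (real \<Rightarrow> complex) \<Rightarrow> bool" where
  "periodic L f \<longleftrightarrow> (\<forall>x. f (x + L) = f x)"

definition torus_L2 :: "real \<Rightarrow> (real \<Rightarrow> complex) set" where
  "torus_L2 L = {f. f \<in> borel_measurable lebesgue \<and> periodic L f \<and>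
                    set_integrable lebesgue {0..L} (\<lambda>x. (cmod (f x))\<^sup>2)}"

definition torus_inner :: "real \<Rightarrow> (real \<Rightarrow> complex) \<Rightarrow> (real \<Rightarrow> complex) \<Rightarrow> complex" where
  "torus_inner L f g = set_lebesgue_integral lebesgue {0..L} (\<lambda>x. cnj (f x) * g x)"

definition torus_norm :: "real \<Rightarrow> (real \<Rightarrow> complex) \<Rightarrow> real" where
  "torus_norm L f = sqrt (Re (torus_inner L f f))"

definition torus_char :: "real \<Rightarrow> real \<Rightarrow> complex" where
  "torus_char L x = complex_of_real (1 / sqrt L) * exp (2 * pi * \<i> * x / L)"

definition torus_fourier :: "real \<Rightarrow> (real \<Rightarrow> complex) \<Rightarrow> int \<Rightarrow> complex" where
  "torus_fourier L f k =
     set_lebesgue_integral lebesgue {0..L} (\<lambda>x. f x * torus_char L (- of_int k * x))"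

text \<open>
  The propagator is the Fourier multiplier with symbol \<open>exp (- 4 \<pi>\<^sup>2 \<i> k\<^sup>2 r / L\<^sup>2)\<close>.  For \<open>f\<close> in
  \<open>torus_L2 L\<close> and \<open>L > 0\<close> a function with the prescribed coefficients exists by Riesz-Fischer and is
  unique up to a null set; the choice operator selects a representative.
\<close>

definition schroedinger :: "real \<Rightarrow> real \<Rightarrow> (real \<Rightarrow> complex) \<Rightarrow> (real \<Rightarrow> complex)" where
  "schroedinger L r f = (SOME u. u \<in> torus_L2 L \<and>
     (\<forall>k. torus_fourier L u k
            = exp (- (4 * pi\<^sup>2 * \<i> * (of_int k)\<^sup>2 * r / L\<^sup>2)) * torus_fourier L f k))"

text \<open>
  For \<open>f1, \<dots>, f4\<close> in \<open>torus_L2 L\<close> the integrand is absolutely integrable over space-time by the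
  periodic \<open>L\<^sup>4\<close> Strichartz estimate, hence the inner integral is genuine for almost every \<open>r\<close>.
\<close>

definition Q4 :: "real \<Rightarrow> (real \<Rightarrow> complex) \<Rightarrow> (real \<Rightarrow> complex) \<Rightarrow> (real \<Rightarrow> complex)
                    \<Rightarrow> (real \<Rightarrow> complex) \<Rightarrow> complex" where
  "Q4 L f1 f2 f3 f4 =
     set_lebesgue_integral lebesgue {0..1} (\<lambda>r.
       set_lebesgue_integral lebesgue {0..L} (\<lambda>x.
         cnj (schroedinger L r f1 x) * schroedinger L r f2 x *
         cnj (schroedinger L r f3 x) * schroedinger L r f4 x))"

text \<open>
  \<open>Q4 L f f f f\<close> is real, being the space-time integral of the fourth power of the modulus of
  \<open>schroedinger L r f\<close>.  The maximum is written as a supremum (finite by Strichartz).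
\<close>

definition omega1 :: "real \<Rightarrow> real" where
  "omega1 L = (SUP f \<in> {f \<in> torus_L2 L. torus_norm L f = 1}. Re (Q4 L f f f f))"

definition weak_solution :: "real \<Rightarrow> real \<Rightarrow> (real \<Rightarrow> complex) \<Rightarrow> bool" where
  "weak_solution L \<omega> f \<longleftrightarrow>
     (\<forall>g \<in> torus_L2 L. complex_of_real \<omega> * torus_inner L g f = Q4 L g f f f)"

definition real_analytic :: "(real \<Rightarrow> complex) \<Rightarrow> bool" where
  "real_analytic h \<longleftrightarrow> (\<forall>x0. \<exists>a :: nat \<Rightarrow> complex. \<exists>\<rho>>0. \<forall>x. \<bar>x - x0\<bar> < \<rho> \<longrightarrow>
     (\<lambda>n. a n * complex_of_real (x - x0) ^ n) sums h x)"

end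

(* Expanding in Fourier modes and using k^2 - l^2 + n^2 - m^2 = 2(k-l)(k-m) for k - l + n - m = 0, the
   time integral of the phase is O(1/(|k-l||k-m|)) off the resonant set {k = l or k = m}. The resonant
   terms sum to (2|f|^2 - |fhat(k)|^2) fhat(k), so the equation yields
     (L omega - 2 + |fhat(k)|^2) fhat(k) = O(sum of |fhat(l) fhat(m) fhat(l+m-k)| / (|k-l||k-m|)).
   The kernel 1/|p| is square summable, so Cauchy-Schwarz bounds the right-hand side in l^2; the same
   bound yields the L^4 Strichartz estimate. Three equal modes -1, 0, 1 give 19 resonances of
   size about 1/9, hence L omega_1 > 2 for large L, and the linear term controls fhat(k).
   Exponential decay then follows by bootstrapping with the submultiplicative weights
   min(rho^|k|, 2^j): if |k| is large, either all three factors have high frequency (small in l^2) or one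
   of |k-l|, |k-m| is large (small kernel); raising j by one at most doubles the weighted norm. *)
theory Submission
  imports Defs "HOL-Complex_Analysis.Cauchy_Integral_Formula"
begin

section \<open>Uniqueness of Fourier coefficients\<close>

text \<open>The operator \<open>schroedinger\<close> makes a separate choice at each time, so its
  dependence on \<open>r\<close> is uncontrolled. The quartic form is therefore computed on finite
  Fourier sums, where every integral is explicit, and carried to general data by a jointly
  measurable limit that agrees with the chosen function almost everywhere at each time. Hence the
  estimates hold for finite index sets with constants independent of the set, and the inequality for
  the modes carries an arbitrarily small error.

  The threshold 2 is delicate: for unit mass the resonant terms alone stay below it, so the lower
  bound on L omega_1 must gain from nonresonant interactions, whose phases are nearly stationary for
  large L. Two equal neighbouring modes would give 6/4, three give 19/9.

  The cap \<open>2^j\<close> in the weights keeps all weighted quantities finite before any decay is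
  known; bounds uniform in \<open>j\<close> then allow the cap to be removed.\<close>

inductive trig_poly :: "(real \<Rightarrow> complex) \<Rightarrow> bool" where
  trig_poly_mode: "trig_poly (\<lambda>t. c * cis (of_int k * t))"
| trig_poly_add: "trig_poly g \<Longrightarrow> trig_poly h \<Longrightarrow> trig_poly (\<lambda>t. g t + h t)"

lemma trig_poly_mode_mult:
  assumes "trig_poly h"
  shows "trig_poly (\<lambda>t. c * cis (of_int k * t) * h t)"
  using assms
proof induction
  case (trig_poly_mode d l)
  have "(\<lambda>t. c * cis (of_int k * t) * (d * cis (of_int l * t))) = (\<lambda>t. (c * d) * cis (of_int (k + l) * t))"
    by (auto simp: algebra_simps cis_mult)
  then show ?case using trig_poly.trig_poly_mode[of "c * d" "k + l"] by simp
next
  case (trig_poly_add g h)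
  then show ?case using trig_poly.trig_poly_add[OF trig_poly_add.IH] by (simp add: distrib_left)
qed

lemma trig_poly_mult:
  assumes "trig_poly g" "trig_poly h"
  shows "trig_poly (\<lambda>t. g t * h t)"
  using assms(1)
proof induction
  case (trig_poly_mode c k)
  then show ?case using trig_poly_mode_mult[OF assms(2)] by simp
next
  case (trig_poly_add g1 g2)
  then show ?case using trig_poly.trig_poly_add[OF trig_poly_add.IH] by (simp add: distrib_right)
qed

lemma trig_poly_const: "trig_poly (\<lambda>t. c)"
  using trig_poly_mode[of c 0] by simp

text \<open>The linear case is Euler's formula: a real linear map is determined by its values at
  \<open>1\<close> and \<open>\<i>\<close>, and cosine and sine are combinations of
  \<open>cis t\<close> and \<open>cis (-t)\<close>.\<close>

lemma trig_poly_real_polynomial: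
  assumes "real_polynomial_function q"
  shows "trig_poly (\<lambda>t. complex_of_real (q (cis t)))"
  using assms
proof induction
  case (linear h)
  then interpret bounded_linear h .
  have "complex_of_real (h (cis t)) =
     (of_real (h 1) / 2 - \<i> * of_real (h \<i>) / 2) * cis (of_int 1 * t) +
     (of_real (h 1) / 2 + \<i> * of_real (h \<i>) / 2) * cis (of_int (-1) * t)" for t
  proof -
    have "cis t = cos t *\<^sub>R 1 + sin t *\<^sub>R \<i>"
      by (simp add: complex_eq_iff)
    then have "h (cis t) = cos t * h 1 + sin t * h \<i>"
      by (metis add scaleR real_scaleR_def)
    then show ?thesis by (simp add: complex_eq_iff field_simps)
  qed
  then show ?case
    using trig_poly_add[OF trig_poly_mode[of "of_real (h 1) / 2 - \<i> * of_real (h \<i>) / 2" 1]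
       trig_poly_mode[of "of_real (h 1) / 2 + \<i> * of_real (h \<i>) / 2" "-1"]] by simp
next
  case (const c)
  then show ?case by (rule trig_poly_const)
next
  case (add f g)
  then show ?case using trig_poly_add by simp
next
  case (mult f g)
  then show ?case using trig_poly_mult by simp
qed

text \<open>Weierstrass for periodic functions: \<open>p\<close> is wrapped onto the unit circle,
  where Stone-Weierstrass gives a polynomial in the real and imaginary parts, and such a polynomial
  is trigonometric along \<open>cis t\<close>.\<close>

lemma trig_poly_approx:
  fixes p :: "real \<Rightarrow> complex"
  assumes L: "L > 0" and p: "continuous_on {0..L} p" "p 0 = p L" and e: "e > 0"
  obtains g where "trig_poly g" "\<And>x. x \<in> {0..L} \<Longrightarrow> cmod (p x - g (2 * pi * x / L)) < e"
proof -
  define \<gamma> where "\<gamma> = (\<lambda>s. p (L * s))"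
  have "continuous_on {0..1} \<gamma>"
    unfolding \<gamma>_def
    by (rule continuous_on_compose2[OF p(1)]) (use L in \<open>auto intro!: continuous_intros simp: mult_left_le\<close>)
  then have "path \<gamma>" by (simp add: path_def)
  moreover have "pathfinish \<gamma> = pathstart \<gamma>"
    using p(2) by (simp add: pathfinish_def pathstart_def \<gamma>_def)
  \<comment> \<open>The trivial homotopy of the loop with itself serves to obtain continuity on the
    circle across the branch cut of \<open>Arg2pi\<close>, where the ends of the loop match.\<close>
  ultimately have "homotopic_loops UNIV \<gamma> \<gamma>"
    by (simp add: homotopic_loops_refl)
  from homotopic_loops_imp_homotopic_circlemaps[OF this]
  have "continuous_on (sphere 0 1) (\<gamma> \<circ> (\<lambda>z. Arg2pi z / (2 * pi)))"
    using homotopic_with_imp_continuous by blast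
  from Stone_Weierstrass_polynomial_function[OF compact_sphere this e]
  obtain q where q: "polynomial_function q"
    "\<And>z. z \<in> sphere 0 1 \<Longrightarrow> cmod ((\<gamma> \<circ> (\<lambda>z. Arg2pi z / (2 * pi))) z - q z) < e" by blast
  have "real_polynomial_function (\<lambda>z. Re (q z))" "real_polynomial_function (\<lambda>z. Im (q z))"
    using q(1) bounded_linear_Re bounded_linear_Im by (auto simp: polynomial_function_def o_def)
  then have "trig_poly (\<lambda>t. complex_of_real (Re (q (cis t))) + \<i> * complex_of_real (Im (q (cis t))))"
    by (intro trig_poly_add trig_poly_mult trig_poly_const trig_poly_real_polynomial)
  moreover have "complex_of_real (Re (q (cis t))) + \<i> * complex_of_real (Im (q (cis t))) = q (cis t)" for t
    by (simp add: complex_eq_iff)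
  ultimately have tq: "trig_poly (\<lambda>t. q (cis t))" by simp
  have "cmod (p x - q (cis (2 * pi * x / L))) < e" if x: "x \<in> {0..L}" for x
  \<comment> \<open>\<open>Arg2pi\<close> takes values in [0, 2 pi), so the endpoint
    \<open>L\<close> is read off at parameter 0, where \<open>p 0 = p L\<close> applies.\<close>
  proof (cases "x = L")
    case True
    then have "cis (2 * pi * x / L) = 1" using L by (simp add: complex_eq_iff)
    then show ?thesis using q(2)[of 1] p(2) True by (simp add: \<gamma>_def Arg2pi_of_real[of 1, simplified])
  next
    case False
    then have "0 \<le> 2 * pi * x / L" "2 * pi * x / L < 2 * pi" using x L by (auto simp: field_simps)
    then have "Arg2pi (cis (2 * pi * x / L)) = 2 * pi * x / L"
      by (intro Arg2pi_unique[of 1]) (auto simp: cis_conv_exp)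
    then show ?thesis using q(2)[of "cis (2 * pi * x / L)"] L by (simp add: \<gamma>_def)
  qed
  with tq show ?thesis by (rule that)
qed

text \<open>Uniform approximation extends the vanishing from modes to continuous functions with
  matching ends, and dominated convergence extends it to \<open>cnj (sgn f)\<close>, which yields
  the L^1 norm of \<open>f\<close>.\<close>

lemma torus_fourier_unique_L1:
  fixes f :: "real \<Rightarrow> complex"
  assumes L: "L > 0" and f: "integrable (lebesgue_on {0..L}) f"
    and zero: "\<And>k::int. integral\<^sup>L (lebesgue_on {0..L}) (\<lambda>x. f x * cis (of_int k * (2 * pi * x / L))) = 0"
  shows "AE x in lebesgue_on {0..L}. f x = 0"
proof -
  let ?X = "lebesgue_on {0..L}"
  have [measurable]: "f \<in> borel_measurable ?X" using f by auto
  have cont_meas: "g \<in> borel_measurable ?X" if "continuous_on UNIV g" for g :: "real \<Rightarrow> complex"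
    by (rule continuous_imp_measurable_on_sets_lebesgue) (auto intro: continuous_on_subset[OF that])
  have f_bdd: "integrable ?X (\<lambda>x. f x * g x)"
    if "g \<in> borel_measurable ?X" "\<And>x. x \<in> {0..L} \<Longrightarrow> cmod (g x) \<le> B" for g B
    by (rule Bochner_Integration.integrable_bound[where f = "\<lambda>x. B * cmod (f x)"])
       (use f that in \<open>auto intro!: AE_I2 simp: norm_mult space_lebesgue_on\<close>,
        metis abs_ge_self mult.commute mult_left_mono norm_ge_zero order_trans atLeastAtMost_iff)
  have trig: "integral\<^sup>L ?X (\<lambda>x. f x * g (2 * pi * x / L)) = 0 \<and> integrable ?X (\<lambda>x. f x * g (2 * pi * x / L))
      \<and> (\<lambda>x. g (2 * pi * x / L)) \<in> borel_measurable ?X"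
    if "trig_poly g" for g
    using that
  proof induction
    case (trig_poly_mode c k)
    have m: "(\<lambda>x. c * cis (of_int k * (2 * pi * x / L))) \<in> borel_measurable ?X"
      by (rule cont_meas) (use L in \<open>auto intro!: continuous_intros\<close>)
    have "integral\<^sup>L ?X (\<lambda>x. f x * (c * cis (of_int k * (2 * pi * x / L)))) =
          integral\<^sup>L ?X (\<lambda>x. c * (f x * cis (of_int k * (2 * pi * x / L))))"
      by (simp add: ac_simps)
    also have "\<dots> = 0" using zero[of k] by simp
    finally show ?case using m f_bdd[OF m, of "cmod c"] by (auto simp: norm_mult)
  next
    case (trig_poly_add g h)
    then show ?case by (auto simp: distrib_left intro!: borel_measurable_add)
  qed
  have cont0: "integral\<^sup>L ?X (\<lambda>x. f x * p x) = 0" if p: "continuous_on UNIV p" "p 0 = p L" for p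
  proof (rule ccontr)
    assume nz: "integral\<^sup>L ?X (\<lambda>x. f x * p x) \<noteq> 0"
    define n where "n = integral\<^sup>L ?X (\<lambda>x. cmod (f x))"
    \<comment> \<open>The \<open>+ 1\<close> keeps the denominator positive. An
      \<open>e\<close>-approximation bounds the integral by \<open>n * e\<close>, less than its own
      modulus \<open>2 * (n + 1) * e\<close>.\<close>
    define e where "e = cmod (integral\<^sup>L ?X (\<lambda>x. f x * p x)) / (2 * (n + 1))"
    have n0: "n \<ge> 0" by (simp add: n_def)
    have np: "0 < 2 * (n + (1::real))" by (intro mult_pos_pos add_nonneg_pos n0) auto
    have e0: "e > 0" unfolding e_def by (rule divide_pos_pos[OF _ np]) (use nz in simp)
    have pc: "continuous_on {0..L} p" using p(1) continuous_on_subset by blast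
    obtain g where g: "trig_poly g" "\<And>x. x \<in> {0..L} \<Longrightarrow> cmod (p x - g (2 * pi * x / L)) < e"
      using trig_poly_approx[OF L pc p(2) e0] by blast
    have [measurable]: "p \<in> borel_measurable ?X" "(\<lambda>x. g (2 * pi * x / L)) \<in> borel_measurable ?X"
      using cont_meas[OF p(1)] trig[OF g(1)] by auto
    have i1: "integrable ?X (\<lambda>x. f x * (p x - g (2 * pi * x / L)))"
      by (rule f_bdd[of _ e]) (use g(2) in \<open>auto intro: less_imp_le\<close>)
    have "(\<lambda>x. f x * p x) = (\<lambda>x. f x * (p x - g (2 * pi * x / L)) + f x * g (2 * pi * x / L))"
      by (auto simp: algebra_simps)
    then have "integral\<^sup>L ?X (\<lambda>x. f x * p x) = integral\<^sup>L ?X (\<lambda>x. f x * (p x - g (2 * pi * x / L)))"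
      using i1 trig[OF g(1)] by simp
    also have "cmod \<dots> \<le> integral\<^sup>L ?X (\<lambda>x. cmod (f x * (p x - g (2 * pi * x / L))))"
      by (rule integral_norm_bound)
    also have "\<dots> \<le> integral\<^sup>L ?X (\<lambda>x. cmod (f x) * e)"
    proof (rule integral_mono)
      show "integrable ?X (\<lambda>x. cmod (f x * (p x - g (2 * pi * x / L))))" using i1 by simp
      show "integrable ?X (\<lambda>x. cmod (f x) * e)" using f by simp
      fix x assume "x \<in> space ?X"
      then show "cmod (f x * (p x - g (2 * pi * x / L))) \<le> cmod (f x) * e"
        using less_imp_le[OF g(2)[of x]] by (auto simp: norm_mult intro!: mult_left_mono)
    qed
    also have "\<dots> = n * e" by (simp add: n_def)
    also have "\<dots> < cmod (integral\<^sup>L ?X (\<lambda>x. f x * p x))"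
    proof -
      have "cmod (integral\<^sup>L ?X (\<lambda>x. f x * p x)) = 2 * (n + 1) * e"
        using np unfolding e_def by simp
      moreover have "n * e < 2 * (n + 1) * e"
        by (rule mult_strict_right_mono) (use n0 e0 in auto)
      ultimately show ?thesis by simp
    qed
    finally show False by simp
  qed
  \<comment> \<open>f * s = |f|, and s is an a.e. limit of uniformly bounded continuous functions vanishing at 0 and L.\<close>
  define s where "s = (\<lambda>x. cnj (sgn (f x)))"
  have fs: "f x * s x = complex_of_real (cmod (f x))" for x
  proof (cases "f x = 0")
    case False
    have "f x * s x = (f x * cnj (f x)) / of_real (cmod (f x))"
      by (simp add: s_def sgn_div_norm scaleR_conv_of_real divide_inverse mult.commute)
    also have "f x * cnj (f x) = of_real (cmod (f x)) * of_real (cmod (f x))"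
      by (simp add: complex_norm_square[symmetric] power2_eq_square)
    finally show ?thesis using False by simp
  qed (simp add: s_def)
  have "cnj \<in> borel_measurable borel"
    by (intro borel_measurable_continuous_onI continuous_intros)
  then have sm: "s \<in> borel_measurable ?X" unfolding s_def sgn_div_norm by measurable
  then have "s measurable_on {0..L}"
    by (subst measurable_on_iff_borel_measurable) auto
  then obtain N g where N: "negligible N" and g: "\<And>n::nat. continuous_on UNIV (g n)"
    "\<And>x. x \<notin> N \<Longrightarrow> (\<lambda>n. g n x) \<longlonglongrightarrow> (if x \<in> {0..L} then s x else 0)"
    unfolding measurable_on_def by blast
  \<comment> \<open>Radial projection onto the closed unit disc: it bounds the approximants supplied
    by measurability and leaves \<open>s\<close>, of modulus at most 1, unchanged.\<close>
  define cl where "cl = (\<lambda>z::complex. z / of_real (max 1 (cmod z)))"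
  have cl_cont: "continuous_on UNIV cl"
    unfolding cl_def by (intro continuous_intros) (auto simp: max_def)
  have cl_le: "cmod (cl z) \<le> 1" for z
    by (auto simp: cl_def norm_divide max_def divide_le_eq)
  have cl_id: "cl (s x) = s x" for x
    by (auto simp: cl_def s_def norm_sgn)
  define \<eta> where "\<eta> = (\<lambda>n x. max 0 (min 1 (real n * (x * (L - x)))))"
  have chi_lim: "(\<lambda>n. \<eta> n x) \<longlonglongrightarrow> 1" if "x \<in> {0<..<L}" for x
  proof -
    have pos: "x * (L - x) > 0" using that by auto
    obtain n0 where n0: "1 < real n0 * (x * (L - x))" using reals_Archimedean3[OF pos] by blast
    have "eventually (\<lambda>n. \<eta> n x = 1) sequentially"
      using eventually_ge_at_top[of n0]
    proof eventually_elim
      case (elim n)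
      then have "real n0 * (x * (L - x)) \<le> real n * (x * (L - x))"
        using pos by (intro mult_right_mono) auto
      then show ?case using n0 by (auto simp: \<eta>_def)
    qed
    then show ?thesis by (rule tendsto_eventually)
  qed
  define h where "h = (\<lambda>n x. of_real (\<eta> n x) * cl (g n x))"
  have h_cont: "continuous_on UNIV (h n)" for n
  proof -
    have "continuous_on UNIV (\<lambda>x. cl (g n x))"
      by (rule continuous_on_compose2[OF cl_cont g(1)]) auto
    then show ?thesis unfolding h_def \<eta>_def by (intro continuous_intros)
  qed
  have h_le: "cmod (h n x) \<le> 1" for n x
    using cl_le[of "g n x"] mult_mono[of "\<bar>\<eta> n x\<bar>" 1 "cmod (cl (g n x))" 1]
    by (auto simp: h_def norm_mult \<eta>_def)
  have h0: "integral\<^sup>L ?X (\<lambda>x. f x * h n x) = 0" for n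
    by (rule cont0[OF h_cont]) (simp add: h_def \<eta>_def)
  have aeN: "AE x in ?X. x \<notin> N \<and> x \<noteq> 0 \<and> x \<noteq> L"
  proof -
    have "negligible (N \<union> {0, L})" using N by auto
    then have "N \<union> {0, L} \<in> null_sets lebesgue" by (simp add: negligible_iff_null_sets)
    then have "AE x in lebesgue. x \<notin> N \<union> {0, L}" by (rule AE_not_in)
    then have "AE x in lebesgue. x \<in> {0..L} \<longrightarrow> x \<notin> N \<and> x \<noteq> 0 \<and> x \<noteq> L"
      by eventually_elim auto
    then show ?thesis by (subst AE_restrict_space_iff) auto
  qed
  have "(\<lambda>n. integral\<^sup>L ?X (\<lambda>x. f x * h n x)) \<longlonglongrightarrow> integral\<^sup>L ?X (\<lambda>x. f x * s x)"
  proof (rule integral_dominated_convergence[where w = "\<lambda>x. cmod (f x)"])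
    show "(\<lambda>x. f x * s x) \<in> borel_measurable ?X" using sm by measurable
    show "(\<lambda>x. f x * h n x) \<in> borel_measurable ?X" for n using cont_meas[OF h_cont[of n]] by measurable
    show "integrable ?X (\<lambda>x. cmod (f x))" using f by simp
    show "AE x in ?X. cmod (f x * h n x) \<le> cmod (f x)" for n
      using h_le[of n] by (auto simp: norm_mult mult_left_le)
    show "AE x in ?X. (\<lambda>n. f x * h n x) \<longlonglongrightarrow> f x * s x"
      using aeN AE_space
    proof eventually_elim
      case (elim x)
      then have x: "x \<in> {0<..<L}" by auto
      have "(\<lambda>n. g n x) \<longlonglongrightarrow> s x" using g(2)[of x] elim x by auto
      moreover have "isCont cl (s x)" using cl_cont by (simp add: continuous_on_eq_continuous_at)
      ultimately have "(\<lambda>n. cl (g n x)) \<longlonglongrightarrow> cl (s x)" using isCont_tendsto_compose by blast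
      then have "(\<lambda>n. h n x) \<longlonglongrightarrow> of_real 1 * cl (s x)"
        unfolding h_def by (intro tendsto_intros chi_lim x)
      then show ?case by (auto intro!: tendsto_intros simp: cl_id)
    qed
  qed
  then have "integral\<^sup>L ?X (\<lambda>x. f x * s x) = 0" by (simp add: h0 LIMSEQ_const_iff)
  then have "integral\<^sup>L ?X (\<lambda>x. cmod (f x)) = 0" unfolding fs by simp
  then show ?thesis using integral_nonneg_eq_0_iff_AE[of ?X "\<lambda>x. cmod (f x)"] f by simp
qed

section \<open>A discrete trilinear estimate and exponential decay\<close>

text \<open>The value at 0 is 0, so resonant pairs drop out of the sums below automatically.\<close>

definition recip_abs :: "int \<Rightarrow> real" where "recip_abs p = 1 / real_of_int \<bar>p\<bar>"

lemma recip_abs_nonneg [simp]: "recip_abs p \<ge> 0" by (simp add: recip_abs_def)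

text \<open>Telescoping: the modulus n contributes the two frequencies n and -n, and 2/n^2 \<le>
  4/(n (n + 1)) = 4/n - 4/(n + 1).\<close>

lemma recip_abs_square_sum_interval:
  assumes "R \<ge> (1::nat)"
  shows "(\<Sum>p\<in>{p::int. int R \<le> \<bar>p\<bar> \<and> \<bar>p\<bar> < int R + int m}. (recip_abs p)\<^sup>2) \<le> 4 / real R - 4 / real (R + m)"
proof (induction m)
  case 0
  have "{p::int. int R \<le> \<bar>p\<bar> \<and> \<bar>p\<bar> < int R + int 0} = {}" by auto
  then show ?case using assms by (simp only: sum.empty) (simp add: field_simps)
next
  case (Suc m)
  let ?q = "int R + int m"
  have eq: "{p::int. int R \<le> \<bar>p\<bar> \<and> \<bar>p\<bar> < int R + int (Suc m)} =
     {p::int. int R \<le> \<bar>p\<bar> \<and> \<bar>p\<bar> < int R + int m} \<union> {?q, - ?q}" using assms by auto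
  have fin: "finite {p::int. int R \<le> \<bar>p\<bar> \<and> \<bar>p\<bar> < int R + int m}"
    by (rule finite_subset[of _ "{- ?q..?q}"]) auto
  have "(\<Sum>p\<in>{p::int. int R \<le> \<bar>p\<bar> \<and> \<bar>p\<bar> < int R + int (Suc m)}. (recip_abs p)\<^sup>2) =
     (\<Sum>p\<in>{p::int. int R \<le> \<bar>p\<bar> \<and> \<bar>p\<bar> < int R + int m}. (recip_abs p)\<^sup>2) + (\<Sum>p\<in>{?q, - ?q}. (recip_abs p)\<^sup>2)"
    unfolding eq by (rule sum.union_disjoint) (use fin assms in auto)
  also have "(\<Sum>p\<in>{?q, - ?q}. (recip_abs p)\<^sup>2) = 2 / (real (R + m))\<^sup>2"
    using assms by (simp add: recip_abs_def power_divide) (simp add: power2_eq_square algebra_simps)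
  also have "\<dots> \<le> 4 / real (R + m) - 4 / real (R + Suc m)"
  proof -
    define n where "n = real (R + m)"
    have n: "n \<ge> 1" using assms by (simp add: n_def)
    then have "n * (n + 1) \<le> 2 * n\<^sup>2" by (simp add: power2_eq_square algebra_simps mult_left_le)
    then have "4 / (2 * n\<^sup>2) \<le> 4 / (n * (n + 1))" using n by (intro divide_left_mono) auto
    then have "2 / n\<^sup>2 \<le> 4 / (n * (n + 1))" by simp
    also have "\<dots> = 4 / n - 4 / (n + 1)" using n by (simp add: field_simps)
    finally show ?thesis by (simp add: n_def add_ac)
  qed
  finally show ?case using Suc by linarith
qed

lemma recip_abs_square_sum_tail:
  assumes "R \<ge> (1::nat)" "finite S" "\<And>p. p \<in> S \<Longrightarrow> int R \<le> \<bar>p\<bar>"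
  shows "(\<Sum>p\<in>S. (recip_abs p)\<^sup>2) \<le> 4 / real R"
proof -
  define m where "m = nat (Max ((\<lambda>p. \<bar>p\<bar>) ` S \<union> {0})) + 1"
  have m: "\<bar>p\<bar> < int m" if "p \<in> S" for p
  proof -
    have "\<bar>p\<bar> \<le> Max ((\<lambda>p. \<bar>p\<bar>) ` S \<union> {0})" using that assms(2) by (intro Max_ge) auto
    then show ?thesis unfolding m_def by linarith
  qed
  have "(\<Sum>p\<in>S. (recip_abs p)\<^sup>2) \<le> (\<Sum>p\<in>{p::int. int R \<le> \<bar>p\<bar> \<and> \<bar>p\<bar> < int R + int m}. (recip_abs p)\<^sup>2)"
  proof (rule sum_mono2)
    show "finite {p::int. int R \<le> \<bar>p\<bar> \<and> \<bar>p\<bar> < int R + int m}"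
      by (rule finite_subset[of _ "{- (int R + int m)..int R + int m}"]) auto
    show "S \<subseteq> {p::int. int R \<le> \<bar>p\<bar> \<and> \<bar>p\<bar> < int R + int m}"
      using m assms(3) by fastforce
  qed auto
  also have "\<dots> \<le> 4 / real R - 4 / real (R + m)" by (rule recip_abs_square_sum_interval[OF assms(1)])
  also have "\<dots> \<le> 4 / real R" by simp
  finally show ?thesis .
qed

lemma recip_abs_square_sum:
  assumes "finite S"
  shows "(\<Sum>p\<in>S. (recip_abs p)\<^sup>2) \<le> 4"
proof -
  have "(\<Sum>p\<in>S. (recip_abs p)\<^sup>2) = (\<Sum>p\<in>S - {0}. (recip_abs p)\<^sup>2)"
    using assms by (intro sum.mono_neutral_right) (auto simp: recip_abs_def)
  also have "\<dots> \<le> 4 / real 1" by (rule recip_abs_square_sum_tail) (use assms in auto)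
  finally show ?thesis by simp
qed

text \<open>The two kernels are separate arguments so that either one can be cut off near the
  diagonal on its own; the third frequency is fixed by momentum conservation.\<close>

definition trilinear ::
  "int set \<Rightarrow> (int \<Rightarrow> real) \<Rightarrow> (int \<Rightarrow> real) \<Rightarrow> (int \<Rightarrow> real) \<Rightarrow> int \<Rightarrow> real" where
  "trilinear F \<kappa> \<kappa>' x k = (\<Sum>(l, m)\<in>F \<times> F. \<kappa> (k - l) * \<kappa>' (k - m) * (x l * x m * x (l + m - k)))"

text \<open>Cauchy-Schwarz in \<open>(l, m)\<close> splits off \<open>x l * x m\<close>, whose
  square sum is at most \<open>X * X\<close>. The other factor, summed over \<open>k\<close> as
  well, depends on three independent combinations of the indices and is bounded by a
  product.\<close>

lemma trilinear_l2_bound: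
  fixes x \<kappa> \<kappa>' :: "int \<Rightarrow> real"
  assumes X: "\<And>S. finite S \<Longrightarrow> (\<Sum>k\<in>S. (x k)\<^sup>2) \<le> X"
    and P: "\<And>S. finite S \<Longrightarrow> (\<Sum>k\<in>S. (\<kappa> k)\<^sup>2) \<le> P"
    and Q: "\<And>S. finite S \<Longrightarrow> (\<Sum>k\<in>S. (\<kappa>' k)\<^sup>2) \<le> Q"
    and fin: "finite G" "finite F"
  shows "(\<Sum>k\<in>G. (trilinear F \<kappa> \<kappa>' x k)\<^sup>2) \<le> P * Q * X ^ 3"
proof -
  have nn: "X \<ge> 0" "P \<ge> 0" "Q \<ge> 0" using X[of "{}"] P[of "{}"] Q[of "{}"] by auto
  define z where "z = (\<lambda>k l m. \<kappa> (k - l) * \<kappa>' (k - m) * x (l + m - k))"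
  have pt: "(trilinear F \<kappa> \<kappa>' x k)\<^sup>2 \<le> X * X * (\<Sum>(l, m)\<in>F \<times> F. (z k l m)\<^sup>2)" for k
  proof -
    have "trilinear F \<kappa> \<kappa>' x k = (\<Sum>q\<in>F \<times> F. (x (fst q) * x (snd q)) * z k (fst q) (snd q))"
      unfolding trilinear_def z_def by (auto intro!: sum.cong simp: algebra_simps)
    also have "\<dots>\<^sup>2 \<le> (\<Sum>q\<in>F \<times> F. (x (fst q) * x (snd q))\<^sup>2) * (\<Sum>q\<in>F \<times> F. (z k (fst q) (snd q))\<^sup>2)"
      by (rule Cauchy_Schwarz_ineq_sum)
    also have "(\<Sum>q\<in>F \<times> F. (x (fst q) * x (snd q))\<^sup>2) = (\<Sum>l\<in>F. (x l)\<^sup>2) * (\<Sum>m\<in>F. (x m)\<^sup>2)"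
      by (simp add: sum_product sum.cartesian_product power_mult_distrib case_prod_beta)
    also have "\<dots> * (\<Sum>q\<in>F \<times> F. (z k (fst q) (snd q))\<^sup>2) \<le> X * X * (\<Sum>q\<in>F \<times> F. (z k (fst q) (snd q))\<^sup>2)"
      by (intro mult_right_mono mult_mono X fin nn sum_nonneg) auto
    finally show ?thesis by (simp add: case_prod_beta)
  qed
  \<comment> \<open>The three components add up to \<open>k\<close>, so the change of variables is
    injective, and in the new variables the summand factors.\<close>
  define \<phi> where "\<phi> = (\<lambda>(k::int, l, m). (k - l, k - m, l + m - k))"
  define D where "D = G \<times> F \<times> F"
  define A where "A = fst ` \<phi> ` D"
  define B where "B = fst ` snd ` \<phi> ` D"
  define E where "E = snd ` snd ` \<phi> ` D"
  have finD: "finite A" "finite B" "finite E" using fin by (auto simp: A_def B_def E_def D_def)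
  define w where "w = (\<lambda>(p, q, s). (\<kappa> p)\<^sup>2 * ((\<kappa>' q)\<^sup>2 * (x s)\<^sup>2))"
  have inj: "inj_on \<phi> D" by (auto simp: inj_on_def \<phi>_def)
  have "(\<Sum>k\<in>G. \<Sum>(l, m)\<in>F \<times> F. (z k l m)\<^sup>2) = (\<Sum>t\<in>D. w (\<phi> t))"
    unfolding D_def by (auto simp: sum.cartesian_product z_def w_def \<phi>_def power_mult_distrib intro!: sum.cong)
  also have "\<dots> = (\<Sum>t\<in>\<phi> ` D. w t)" by (simp add: sum.reindex[OF inj])
  also have "\<dots> \<le> (\<Sum>t\<in>A \<times> B \<times> E. w t)"
  proof (rule sum_mono2)
    show "\<phi> ` D \<subseteq> A \<times> B \<times> E"
      by (auto simp: A_def B_def E_def image_iff) (metis fst_conv snd_conv)+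
  qed (use finD in \<open>auto simp: w_def\<close>)
  also have "\<dots> = (\<Sum>p\<in>A. (\<kappa> p)\<^sup>2) * ((\<Sum>q\<in>B. (\<kappa>' q)\<^sup>2) * (\<Sum>s\<in>E. (x s)\<^sup>2))"
    by (simp add: w_def sum_product sum.cartesian_product case_prod_beta)
  also have "\<dots> \<le> P * (Q * X)"
    by (intro mult_mono P Q X finD nn mult_nonneg_nonneg sum_nonneg) auto
  finally have *: "(\<Sum>k\<in>G. \<Sum>(l, m)\<in>F \<times> F. (z k l m)\<^sup>2) \<le> P * (Q * X)" .
  have "(\<Sum>k\<in>G. (trilinear F \<kappa> \<kappa>' x k)\<^sup>2) \<le> X * X * (\<Sum>k\<in>G. \<Sum>(l, m)\<in>F \<times> F. (z k l m)\<^sup>2)"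
    using pt by (simp add: sum_distrib_left sum_mono)
  also have "\<dots> \<le> X * X * (P * (Q * X))" using * nn by (intro mult_left_mono) auto
  finally show ?thesis by (simp add: power3_eq_cube algebra_simps)
qed

text \<open>A finite set \<open>S0\<close> almost attains the supremum of the finite sums, so a
  finite set disjoint from it can add at most \<open>e\<close>.\<close>

lemma l2_small_tail:
  fixes u :: "int \<Rightarrow> real"
  assumes u: "\<And>S. finite S \<Longrightarrow> (\<Sum>k\<in>S. (u k)\<^sup>2) \<le> M" and e: "e > 0"
  obtains n :: nat where "\<And>S. finite S \<Longrightarrow> (\<And>k. k \<in> S \<Longrightarrow> int n < \<bar>k\<bar>) \<Longrightarrow> (\<Sum>k\<in>S. (u k)\<^sup>2) \<le> e"
proof -
  define s where "s = (SUP S\<in>{S. finite S}. \<Sum>k\<in>S. (u k)\<^sup>2)"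
  have bdd: "bdd_above ((\<lambda>S. \<Sum>k\<in>S. (u k)\<^sup>2) ` {S. finite S})" using u by (auto intro!: bdd_aboveI)
  have "s - e < s" using e by simp
  then obtain S0 where S0: "finite S0" "s - e < (\<Sum>k\<in>S0. (u k)\<^sup>2)"
    unfolding s_def using less_cSUP_iff[OF _ bdd] by blast
  define n where "n = nat (Max ((\<lambda>k. \<bar>k\<bar>) ` S0 \<union> {0}))"
  have n: "\<bar>k\<bar> \<le> int n" if "k \<in> S0" for k
  proof -
    have "\<bar>k\<bar> \<le> Max ((\<lambda>p. \<bar>p\<bar>) ` S0 \<union> {0})" using that S0(1) by (intro Max_ge) auto
    then show ?thesis unfolding n_def by linarith
  qed
  show ?thesis
  proof (rule that[of n])
    fix S :: "int set" assume S: "finite S" "\<And>k. k \<in> S \<Longrightarrow> int n < \<bar>k\<bar>"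
    have "S \<inter> S0 = {}" using n S(2) by fastforce
    then have "(\<Sum>k\<in>S. (u k)\<^sup>2) + (\<Sum>k\<in>S0. (u k)\<^sup>2) = (\<Sum>k\<in>S \<union> S0. (u k)\<^sup>2)"
      using S S0 by (simp add: sum.union_disjoint)
    also have "\<dots> \<le> s" unfolding s_def by (rule cSUP_upper[OF _ bdd]) (use S S0 in auto)
    finally show "(\<Sum>k\<in>S. (u k)\<^sup>2) \<le> e" using S0(2) by linarith
  qed
qed

section \<open>Capped exponential weights and the bootstrap\<close>

lemma square_sum4_le: "(a + b + c + d)\<^sup>2 \<le> 4 * (a\<^sup>2 + b\<^sup>2 + c\<^sup>2 + (d::real)\<^sup>2)"
proof -
  have "0 \<le> (a - b)\<^sup>2 + (a - c)\<^sup>2 + (a - d)\<^sup>2 + (b - c)\<^sup>2 + (b - d)\<^sup>2 + (c - d)\<^sup>2" by simp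
  then show ?thesis by (simp add: power2_eq_square algebra_simps)
qed

text \<open>Capping preserves submultiplicativity because all factors are at least 1: once a factor
  is capped, the product already dominates \<open>M\<close>.\<close>

lemma min_mult_le: 
  fixes a b M :: real assumes "a \<ge> 1" "b \<ge> 1" "M \<ge> 1"
  shows "min (a * b) M \<le> min a M * min b M"
proof -
  have "M \<le> M * b" "M \<le> a * M" "M \<le> M * M" using assms by (simp_all add: mult_le_cancel_left1 mult_le_cancel_right1)
  then show ?thesis by (auto simp: min_def)
qed

text \<open>A gap argument on the weighted mass beyond frequency \<open>N\<close>. With the cap
  \<open>2^0\<close> this mass is at most \<open>x0\<close>; doubling the cap multiplies the squares
  by at most 4; \<open>main\<close> brings \<open>4 * x0\<close> back to \<open>x0\<close>. The
  bound is uniform in \<open>j\<close>, so \<open>j\<close> may finally depend on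
  \<open>k\<close>.\<close>

lemma bootstrap_decay:
  fixes u :: "int \<Rightarrow> real"
  assumes u0: "\<And>k. u k \<ge> 0" and u1: "\<And>S. finite S \<Longrightarrow> (\<Sum>k\<in>S. (u k)\<^sup>2) \<le> 1"
    and d: "\<delta> > 0" and C: "C > 0"
    and ineq: "\<And>k e. e > 0 \<Longrightarrow> \<exists>n0::nat. \<forall>n\<ge>n0. \<delta> * u k \<le> e + C * trilinear {- int n..int n} recip_abs recip_abs u k"
  shows "\<exists>\<rho>>1. \<exists>B>0. \<forall>k. u k * \<rho> ^ nat \<bar>k\<bar> \<le> B"
proof -
  \<comment> \<open>256 makes the high-frequency term half of the target:
    \<open>4 * C^2 * 16 * (8 * x0)^3 = x0 * (65536 * C^2 * x0^2) / 2\<close>, and 65536 is the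
    square of 256.\<close>
  define x0 where "x0 = min 1 (\<delta> / (256 * C))"
  have x0: "x0 > 0" "x0 \<le> 1" using d C by (auto simp: x0_def)
  have "x0 \<le> \<delta> / (256 * C)" by (simp add: x0_def)
  then have "256 * C * x0 \<le> \<delta>" using C by (simp add: field_simps)
  then have x0C: "65536 * C\<^sup>2 * x0\<^sup>2 \<le> \<delta>\<^sup>2"
    using power_mono[of "256 * C * x0" \<delta> 2] C x0 by (simp add: power_mult_distrib)
  obtain n where n: "\<And>S. finite S \<Longrightarrow> (\<And>k. k \<in> S \<Longrightarrow> int n < \<bar>k\<bar>) \<Longrightarrow> (\<Sum>k\<in>S. (u k)\<^sup>2) \<le> x0"
    using l2_small_tail[OF u1 x0(1)] by blast
  \<comment> \<open>The two terms with a far kernel add up to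
    \<open>4 * C^2 * 2 * (16 / R) * 8^3\<close>, which is half of
    \<open>131072 * C^2 / R\<close>.\<close>
  obtain R0 where R0: "real R0 \<ge> 131072 * C\<^sup>2 / (\<delta>\<^sup>2 * x0)" using real_arch_simple by blast
  define R where "R = R0 + 1"
  have R1: "R \<ge> 1" by (simp add: R_def)
  have "131072 * C\<^sup>2 / (\<delta>\<^sup>2 * x0) \<le> real R" using R0 by (simp add: R_def)
  then have RC: "131072 * C\<^sup>2 / real R \<le> \<delta>\<^sup>2 * x0" using R1 x0 d by (simp add: field_simps)
  \<comment> \<open>Room for two kernel ranges beyond \<open>n\<close>: if |k| exceeds
    \<open>N\<close> and both |k - l| and |k - m| are below \<open>R\<close>, then \<open>l\<close>,
    \<open>m\<close> and \<open>l + m - k\<close> all exceed \<open>n\<close> in modulus.\<close>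
  define N where "N = n + 2 * R"
  have N: "N > 0" using R1 by (simp add: N_def)
  \<comment> \<open>With this base the weight is still at most 2 on all frequencies up to
    \<open>N\<close>, whatever the cap.\<close>
  define \<rho> where "\<rho> = root N 2"
  have rho1: "\<rho> > 1" using N by (simp add: \<rho>_def)
  have rhoN: "\<rho> ^ N = 2" using N by (simp add: \<rho>_def)
  have rho_ge: "\<rho> ^ i \<ge> 1" for i using rho1 by (simp add: one_le_power)
  define W where "W = (\<lambda>j k. min (\<rho> ^ nat \<bar>k\<bar>) ((2::real) ^ j))"
  have W1: "W j k \<ge> 1" for j k using rho_ge by (simp add: W_def)
  have W0: "W j k \<ge> 0" for j k using W1[of j k] by linarith
  have Wj: "W j k \<le> 2 ^ j" for j k by (simp add: W_def)
  have W2: "W j k \<le> 2" if "\<bar>k\<bar> \<le> int N" for j k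
  proof -
    have "\<rho> ^ nat \<bar>k\<bar> \<le> \<rho> ^ N" using that rho1 by (intro power_increasing) auto
    then show ?thesis by (simp add: W_def rhoN)
  qed
  have Wsub: "W j (k + l) \<le> W j k * W j l" for j k l
  proof -
    have "\<rho> ^ nat \<bar>k + l\<bar> \<le> \<rho> ^ (nat \<bar>k\<bar> + nat \<bar>l\<bar>)" using rho1 by (intro power_increasing) auto
    then have "W j (k + l) \<le> min (\<rho> ^ nat \<bar>k\<bar> * \<rho> ^ nat \<bar>l\<bar>) (2 ^ j)" by (auto simp: W_def power_add min_le_iff_disj)
    also have "\<dots> \<le> W j k * W j l" unfolding W_def by (rule min_mult_le) (use rho_ge in auto)
    finally show ?thesis .
  qed
  have Wneg: "W j (- k) = W j k" for j k by (simp add: W_def)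
  have Wtri: "W j k \<le> W j l * W j m * W j (l + m - k)" for j k l m
  proof -
    have "W j k \<le> W j (l + m) * W j (- (l + m - k))" using Wsub[of j "l + m" "- (l + m - k)"] by simp
    also have "\<dots> \<le> (W j l * W j m) * W j (l + m - k)" unfolding Wneg
      by (intro mult_right_mono Wsub W0)
    finally show ?thesis .
  qed
  have main: "(\<Sum>k\<in>G. (W j k * u k)\<^sup>2) \<le> x0"
    if hyp: "\<And>G. finite G \<Longrightarrow> (\<And>k. k \<in> G \<Longrightarrow> int N < \<bar>k\<bar>) \<Longrightarrow> (\<Sum>k\<in>G. (W j k * u k)\<^sup>2) \<le> 4 * x0"
      and G: "finite G" "\<And>k. k \<in> G \<Longrightarrow> int N < \<bar>k\<bar>" for j G
  proof -
    define v where "v = (\<lambda>k. W j k * u k)"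
    define v' where "v' = (\<lambda>k. if int n < \<bar>k\<bar> then v k else 0)"
    define kb where "kb = (\<lambda>p::int. if int R \<le> \<bar>p\<bar> then recip_abs p else 0)"
    have v0: "v k \<ge> 0" for k using W0 u0 by (simp add: v_def)
    have v'0: "v' k \<ge> 0" for k using v0 by (simp add: v'_def)
    have kb0: "kb p \<ge> 0" for p by (simp add: kb_def)
    have low: "(\<Sum>k\<in>S. (v k)\<^sup>2) \<le> 4 * (\<Sum>k\<in>S. (u k)\<^sup>2)" if "\<And>k. k \<in> S \<Longrightarrow> \<bar>k\<bar> \<le> int N" for S
      unfolding sum_distrib_left
    proof (rule sum_mono)
      fix k assume "k \<in> S"
      then have "v k \<le> 2 * u k" using W2[OF that] u0 by (simp add: v_def mult_right_mono)
      then have "(v k)\<^sup>2 \<le> (2 * u k)\<^sup>2" using v0 by (intro power_mono) auto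
      then show "(v k)\<^sup>2 \<le> 4 * (u k)\<^sup>2" by (simp add: power_mult_distrib)
    qed
    have split: "(\<Sum>k\<in>S. f k) = (\<Sum>k\<in>{k\<in>S. \<bar>k\<bar> \<le> int N}. f k) + (\<Sum>k\<in>{k\<in>S. int N < \<bar>k\<bar>}. f k)"
      if "finite S" for S and f :: "int \<Rightarrow> real"
    proof -
      have "S = {k\<in>S. \<bar>k\<bar> \<le> int N} \<union> {k\<in>S. int N < \<bar>k\<bar>}" by auto
      then show ?thesis using that by (subst sum.union_disjoint[symmetric]) auto
    qed
    \<comment> \<open>At most 4 from frequencies up to \<open>N\<close>, where the weight is at most
      2 and \<open>u\<close> has mass at most 1, plus \<open>4 * x0 \<le> 4\<close> from the
      tail.\<close>
    have V: "(\<Sum>k\<in>S. (v k)\<^sup>2) \<le> 8" if S: "finite S" for S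
    proof -
      have "(\<Sum>k\<in>{k\<in>S. \<bar>k\<bar> \<le> int N}. (v k)\<^sup>2) \<le> 4 * (\<Sum>k\<in>{k\<in>S. \<bar>k\<bar> \<le> int N}. (u k)\<^sup>2)" by (rule low) simp
      also have "\<dots> \<le> 4 * 1" using S by (intro mult_left_mono u1) auto
      finally have 1: "(\<Sum>k\<in>{k\<in>S. \<bar>k\<bar> \<le> int N}. (v k)\<^sup>2) \<le> 4" by simp
      have "(\<Sum>k\<in>{k\<in>S. int N < \<bar>k\<bar>}. (v k)\<^sup>2) \<le> 4 * x0"
        unfolding v_def by (rule hyp) (use S in auto)
      then show ?thesis using 1 x0 split[OF S, of "\<lambda>k. (v k)\<^sup>2"] by linarith
    qed
    have V': "(\<Sum>k\<in>S. (v' k)\<^sup>2) \<le> 8 * x0" if S: "finite S" for S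
    proof -
      have e: "(\<Sum>k\<in>S. (v' k)\<^sup>2) = (\<Sum>k\<in>{k\<in>S. int n < \<bar>k\<bar>}. (v k)\<^sup>2)"
      proof -
        have "(\<Sum>k\<in>S. (v' k)\<^sup>2) = (\<Sum>k\<in>{k\<in>S. int n < \<bar>k\<bar>}. (v' k)\<^sup>2)"
          using S by (intro sum.mono_neutral_right) (auto simp: v'_def)
        then show ?thesis by (simp add: v'_def)
      qed
      let ?S = "{k\<in>S. int n < \<bar>k\<bar>}"
      have "(\<Sum>k\<in>{k\<in>?S. \<bar>k\<bar> \<le> int N}. (v k)\<^sup>2) \<le> 4 * (\<Sum>k\<in>{k\<in>?S. \<bar>k\<bar> \<le> int N}. (u k)\<^sup>2)" by (rule low) simp
      also have "\<dots> \<le> 4 * x0" using S by (intro mult_left_mono n) auto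
      finally have 1: "(\<Sum>k\<in>{k\<in>?S. \<bar>k\<bar> \<le> int N}. (v k)\<^sup>2) \<le> 4 * x0" by simp
      have "(\<Sum>k\<in>{k\<in>?S. int N < \<bar>k\<bar>}. (v k)\<^sup>2) \<le> 4 * x0"
        unfolding v_def by (rule hyp) (use S in auto)
      then show ?thesis using 1 split[of ?S "\<lambda>k. (v k)\<^sup>2"] S unfolding e by simp
    qed
    have KB: "(\<Sum>p\<in>S. (kb p)\<^sup>2) \<le> 4 / real R" if S: "finite S" for S
    proof -
      have "(\<Sum>p\<in>S. (kb p)\<^sup>2) = (\<Sum>p\<in>{p\<in>S. int R \<le> \<bar>p\<bar>}. (kb p)\<^sup>2)"
        using S by (intro sum.mono_neutral_right) (auto simp: kb_def)
      also have "\<dots> = (\<Sum>p\<in>{p\<in>S. int R \<le> \<bar>p\<bar>}. (recip_abs p)\<^sup>2)" by (simp add: kb_def)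
      also have "\<dots> \<le> 4 / real R" by (rule recip_abs_square_sum_tail) (use S R1 in auto)
      finally show ?thesis .
    qed
    have tri: "W j k * trilinear F recip_abs recip_abs u k \<le>
        trilinear F recip_abs recip_abs v' k + trilinear F kb recip_abs v k + trilinear F recip_abs kb v k"
      if k: "int N < \<bar>k\<bar>" for F k
      unfolding trilinear_def sum_distrib_left sum.distrib[symmetric]
    proof (rule sum_mono, clarify)
      fix l m
      have a: "W j k * (u l * u m * u (l + m - k)) \<le> v l * v m * v (l + m - k)"
      proof -
        have "W j k * (u l * u m * u (l + m - k)) \<le> (W j l * W j m * W j (l + m - k)) * (u l * u m * u (l + m - k))"
          by (intro mult_right_mono Wtri mult_nonneg_nonneg u0)
        then show ?thesis by (simp add: v_def algebra_simps)
      qed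
      have "W j k * (recip_abs (k - l) * recip_abs (k - m) * (u l * u m * u (l + m - k))) \<le>
          recip_abs (k - l) * recip_abs (k - m) * (v l * v m * v (l + m - k))"
        using mult_left_mono[OF a, of "recip_abs (k - l) * recip_abs (k - m)"] by (simp add: algebra_simps)
      also have "\<dots> \<le> recip_abs (k - l) * recip_abs (k - m) * (v' l * v' m * v' (l + m - k)) +
          kb (k - l) * recip_abs (k - m) * (v l * v m * v (l + m - k)) +
          recip_abs (k - l) * kb (k - m) * (v l * v m * v (l + m - k))"
      proof -
        have nn: "recip_abs (k - l) * recip_abs (k - m) * (v' l * v' m * v' (l + m - k)) \<ge> 0"
          "kb (k - l) * recip_abs (k - m) * (v l * v m * v (l + m - k)) \<ge> 0"
          "recip_abs (k - l) * kb (k - m) * (v l * v m * v (l + m - k)) \<ge> 0"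
          by (intro mult_nonneg_nonneg recip_abs_nonneg kb0 v0 v'0)+
        consider "int R \<le> \<bar>k - l\<bar>" | "int R \<le> \<bar>k - m\<bar>"
          | "int n < \<bar>l\<bar>" "int n < \<bar>m\<bar>" "int n < \<bar>l + m - k\<bar>"
          using k unfolding N_def by fastforce
        then show ?thesis
        proof cases
          case 1 then show ?thesis using nn by (simp add: kb_def)
        next
          case 2 then show ?thesis using nn by (simp add: kb_def)
        next
          case 3
          then have "v' l = v l" "v' m = v m" "v' (l + m - k) = v (l + m - k)" by (auto simp: v'_def)
          then show ?thesis using nn by simp
        qed
      qed
      finally show "W j k * (recip_abs (k - l) * recip_abs (k - m) * (u l * u m * u (l + m - k)))
        \<le> recip_abs (k - l) * recip_abs (k - m) * (v' l * v' m * v' (l + m - k)) +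
          kb (k - l) * recip_abs (k - m) * (v l * v m * v (l + m - k)) +
          recip_abs (k - l) * kb (k - m) * (v l * v m * v (l + m - k))" .
    qed
    have tri0: "trilinear F recip_abs recip_abs v' k \<ge> 0" "trilinear F kb recip_abs v k \<ge> 0" "trilinear F recip_abs kb v k \<ge> 0" for F k
      unfolding trilinear_def by (auto intro!: sum_nonneg mult_nonneg_nonneg v0 v'0 kb0)
    have "\<delta>\<^sup>2 * (\<Sum>k\<in>G. (v k)\<^sup>2) \<le> \<delta>\<^sup>2 * x0 + \<epsilon>" if eps: "\<epsilon> > 0" for \<epsilon>
    proof -
      \<comment> \<open>The error in \<open>ineq\<close> is multiplied by a weight of at most
        \<open>2^j\<close> and its square is summed over \<open>G\<close>. Since \<open>e\<close> is
        chosen after both, the total contribution is at most \<epsilon>.\<close>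
      define e where "e = sqrt (\<epsilon> / (4 * (real (card G) + 1) * 4 ^ j))"
      have e0: "e > 0" using eps by (simp add: e_def)
      have e2: "4 * real (card G) * (4 ^ j * e\<^sup>2) \<le> \<epsilon>"
      proof -
        have "4 * real (card G) * (4 ^ j * e\<^sup>2) = \<epsilon> * (real (card G) / (real (card G) + 1))"
        proof -
          have "e\<^sup>2 = \<epsilon> / (4 * (real (card G) + 1) * 4 ^ j)" using eps by (simp add: e_def)
          moreover have "4 * real c * (q * (\<epsilon> / (4 * (real c + 1) * q))) = \<epsilon> * (real c / (real c + 1))"
            if "q > 0" for q c 
          proof -
            have "4 * real c * (q * (\<epsilon> / (4 * (real c + 1) * q))) = (4 * q) * (\<epsilon> * real c) / ((4 * q) * (real c + 1))"
              by (simp add: ac_simps)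
            then show ?thesis using that by (simp only: mult_divide_mult_cancel_left) simp
          qed
          ultimately show ?thesis by (simp only: zero_less_power zero_less_numeral)
        qed
        also have "\<dots> \<le> \<epsilon> * 1" using eps by (intro mult_left_mono) (auto simp: divide_le_eq)
        finally show ?thesis by simp
      qed
      obtain n0 where n0: "\<And>k n. n \<ge> n0 k \<Longrightarrow> \<delta> * u k \<le> e + C * trilinear {- int n..int n} recip_abs recip_abs u k"
        using ineq[OF e0] by metis
      \<comment> \<open>One truncation level that is large enough for every \<open>k\<close> of the
        finite set \<open>G\<close>.\<close>
      define nn where "nn = Max (n0 ` G)"
      define F where "F = {- int nn..int nn}"
      have pt: "(\<delta> * v k)\<^sup>2 \<le> 4 * ((2 ^ j * e)\<^sup>2 + (C * trilinear F recip_abs recip_abs v' k)\<^sup>2 +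
          (C * trilinear F kb recip_abs v k)\<^sup>2 + (C * trilinear F recip_abs kb v k)\<^sup>2)" if k: "k \<in> G" for k
      proof -
        have "n0 k \<le> nn" unfolding nn_def using G(1) k by (intro Max_ge) auto
        from n0[OF this] have "\<delta> * u k \<le> e + C * trilinear F recip_abs recip_abs u k" by (simp add: F_def)
        then have "\<delta> * v k \<le> W j k * (e + C * trilinear F recip_abs recip_abs u k)"
          using mult_left_mono[OF _ W0[of j k]] by (fastforce simp: v_def mult.left_commute)
        also have "\<dots> = W j k * e + C * (W j k * trilinear F recip_abs recip_abs u k)" by (simp add: algebra_simps)
        also have "\<dots> \<le> 2 ^ j * e + C * (trilinear F recip_abs recip_abs v' k + trilinear F kb recip_abs v k + trilinear F recip_abs kb v k)"
          by (intro add_mono mult_right_mono mult_left_mono Wj tri G(2) k) (use e0 C in auto)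
        finally have "\<delta> * v k \<le> 2 ^ j * e + C * trilinear F recip_abs recip_abs v' k + C * trilinear F kb recip_abs v k + C * trilinear F recip_abs kb v k"
          by (simp add: algebra_simps)
        then have "(\<delta> * v k)\<^sup>2 \<le> (2 ^ j * e + C * trilinear F recip_abs recip_abs v' k + C * trilinear F kb recip_abs v k + C * trilinear F recip_abs kb v k)\<^sup>2"
          using d v0 by (intro power_mono) auto
        also note square_sum4_le
        finally show ?thesis .
      qed
      have "\<delta>\<^sup>2 * (\<Sum>k\<in>G. (v k)\<^sup>2) = (\<Sum>k\<in>G. (\<delta> * v k)\<^sup>2)"
        by (simp add: sum_distrib_left power_mult_distrib)
      also have "\<dots> \<le> (\<Sum>k\<in>G. 4 * ((2 ^ j * e)\<^sup>2 + (C * trilinear F recip_abs recip_abs v' k)\<^sup>2 +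
          (C * trilinear F kb recip_abs v k)\<^sup>2 + (C * trilinear F recip_abs kb v k)\<^sup>2))"
        by (rule sum_mono) (rule pt)
      also have "\<dots> = 4 * real (card G) * (4 ^ j * e\<^sup>2) + 4 * C\<^sup>2 * ((\<Sum>k\<in>G. (trilinear F recip_abs recip_abs v' k)\<^sup>2) +
          (\<Sum>k\<in>G. (trilinear F kb recip_abs v k)\<^sup>2) + (\<Sum>k\<in>G. (trilinear F recip_abs kb v k)\<^sup>2))"
        by (simp add: sum.distrib sum_distrib_left[symmetric] power_mult_distrib power_even_eq algebra_simps)
           (simp add: power_mult_distrib[symmetric] power2_eq_square)
      also have "\<dots> \<le> \<epsilon> + 4 * C\<^sup>2 * (4 * 4 * (8 * x0) ^ 3 + 4 / real R * 4 * 8 ^ 3 + 4 * (4 / real R) * 8 ^ 3)"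
        by (intro add_mono mult_left_mono e2 trilinear_l2_bound V V' KB recip_abs_square_sum G)
           (auto simp: F_def)
      also have "\<dots> = \<epsilon> + x0 * (65536 * C\<^sup>2 * x0\<^sup>2) / 2 + (131072 * C\<^sup>2 / real R) / 2"
        by (simp add: power2_eq_square power3_eq_cube) (simp add: algebra_simps)
      also have "\<dots> \<le> \<epsilon> + x0 * \<delta>\<^sup>2 / 2 + \<delta>\<^sup>2 * x0 / 2"
        by (intro add_mono divide_right_mono mult_left_mono x0C RC) (use x0 in auto)
      finally show ?thesis by (simp add: algebra_simps)
    qed
    then have "\<delta>\<^sup>2 * (\<Sum>k\<in>G. (v k)\<^sup>2) \<le> \<delta>\<^sup>2 * x0" by (rule field_le_epsilon)
    then show ?thesis using d by (simp add: v_def)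
  qed
  have all: "(\<Sum>k\<in>G. (W j k * u k)\<^sup>2) \<le> x0" if G: "finite G" "\<And>k. k \<in> G \<Longrightarrow> int N < \<bar>k\<bar>" for j G
    using that
  proof (induction j arbitrary: G)
    case 0
    have "W 0 k = 1" for k using rho_ge by (simp add: W_def min_def antisym)
    then show ?case using n[of G] 0 by (fastforce simp: N_def)
  next
    case (Suc j)
    show ?case
    proof (rule main)
      fix G' :: "int set" assume G': "finite G'" "\<And>k. k \<in> G' \<Longrightarrow> int N < \<bar>k\<bar>"
      have "(W (Suc j) k * u k)\<^sup>2 \<le> 4 * (W j k * u k)\<^sup>2" for k
      proof -
        have "W (Suc j) k \<le> 2 * W j k" using rho_ge[of "nat \<bar>k\<bar>"] by (auto simp: W_def min_def)
        then have "W (Suc j) k * u k \<le> 2 * W j k * u k" using u0 by (intro mult_right_mono)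
        then have "(W (Suc j) k * u k)\<^sup>2 \<le> (2 * W j k * u k)\<^sup>2" using W0 u0 by (intro power_mono) auto
        then show ?thesis by (simp add: power_mult_distrib)
      qed
      then have "(\<Sum>k\<in>G'. (W (Suc j) k * u k)\<^sup>2) \<le> 4 * (\<Sum>k\<in>G'. (W j k * u k)\<^sup>2)"
        by (simp add: sum_distrib_left sum_mono)
      then show "(\<Sum>k\<in>G'. (W (Suc j) k * u k)\<^sup>2) \<le> 4 * x0" using Suc.IH[OF G'] by linarith
    qed (use Suc.prems in auto)
  qed
  have "u k * \<rho> ^ nat \<bar>k\<bar> \<le> 2" for k
  proof -
    \<comment> \<open>With the cap above the exponential weight at this \<open>k\<close>,
      \<open>W j k\<close> is the uncapped weight.\<close>
    obtain j where j: "\<rho> ^ nat \<bar>k\<bar> < 2 ^ j" using real_arch_pow[of 2] by force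
    then have Wk: "W j k = \<rho> ^ nat \<bar>k\<bar>" by (simp add: W_def)
    have uk: "u k \<le> 1" using u1[of "{k}"] u0[of k] by (simp add: abs_square_le_1)
    show ?thesis
    proof (cases "int N < \<bar>k\<bar>")
      case True
      then have "(W j k * u k)\<^sup>2 \<le> 1" using all[of "{k}" j] x0 by simp
      then have "W j k * u k \<le> 1" using abs_square_le_1 by (meson abs_le_D1)
      then show ?thesis by (simp add: Wk mult.commute)
    next
      case False
      then have "W j k \<le> 2" by (intro W2) auto
      then show ?thesis using mult_mono[OF uk, of "W j k" 2] W0[of j k] by (simp add: Wk)
    qed
  qed
  then show ?thesis using rho1 by (intro exI[of _ \<rho>]) (auto intro: exI[of _ 2])
qed

section \<open>Modes of the periodic Schroedinger flow\<close>

abbreviation torus :: "real \<Rightarrow> real measure" where "torus L \<equiv> lebesgue_on {0..L}"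
abbreviation time :: "real measure" where "time \<equiv> lebesgue_on {0..1}"

text \<open>The free solution whose initial datum is the character of frequency \<open>k\<close>; at
  \<open>r = 0\<close> it is the Fourier basis.\<close>

definition mode :: "real \<Rightarrow> int \<Rightarrow> real \<Rightarrow> real \<Rightarrow> complex" where
  "mode L k r x = complex_of_real (1 / sqrt L) *
     cis (2 * pi * of_int k * x / L - 4 * pi\<^sup>2 * (of_int k)\<^sup>2 * r / L\<^sup>2)"

text \<open>It is used at \<open>n = (k - l) * (k - m)\<close>: the integrand is then what remains
  of the four propagator phases, \<open>4 * pi^2\<close> times the factor 2 of the resonance
  identity.\<close>

definition phase_integral :: "real \<Rightarrow> int \<Rightarrow> complex" where
  "phase_integral L n = integral\<^sup>L time (\<lambda>r. cis (8 * pi\<^sup>2 * of_int n / L\<^sup>2 * r))"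

lemma set_lebesgue_integral_lebesgue_on:
  fixes f :: "real \<Rightarrow> 'a::{banach, second_countable_topology}"
  shows "set_lebesgue_integral lebesgue {a..b} f = integral\<^sup>L (lebesgue_on {a..b}) f"
  unfolding set_lebesgue_integral_def by (rule integral_restrict_space[symmetric]) simp

lemma set_integrable_lebesgue_on:
  fixes f :: "real \<Rightarrow> 'a::{banach, second_countable_topology}"
  shows "set_integrable lebesgue {a..b} f \<longleftrightarrow> integrable (lebesgue_on {a..b}) f"
  unfolding set_integrable_def by (rule integrable_restrict_space[symmetric]) simp

lemma finite_measure_interval: "finite_measure (lebesgue_on {a..b::real})"
  by (rule finite_measure_lebesgue_on) simp

lemma borel_measurable_cis [measurable]: "cis \<in> borel_measurable borel"
  by (intro borel_measurable_continuous_onI continuous_intros)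

lemma borel_measurable_cnj [measurable]: "cnj \<in> borel_measurable borel"
  by (intro borel_measurable_continuous_onI continuous_intros)

lemma borel_measurable_ident_lebesgue_on [measurable]: 
  "(\<lambda>x::real. x) \<in> borel_measurable (lebesgue_on S)"
  using id_borel_measurable_lebesgue_on[of S] by (simp add: id_def)

lemma integrable_bounded_interval:
  fixes f :: "real \<Rightarrow> complex"
  assumes "f \<in> borel_measurable (lebesgue_on {a..b})" "\<And>x. cmod (f x) \<le> B"
  shows "integrable (lebesgue_on {a..b}) f"
  by (rule finite_measure.integrable_const_bound[OF finite_measure_interval, of _ B]) (use assms in auto)

section \<open>Oscillatory integrals over time and over one period\<close>

lemma integral_cis:
  fixes c l :: real
  assumes "c \<noteq> 0" "l \<ge> 0"
  shows "integral\<^sup>L (lebesgue_on {0..l}) (\<lambda>x. cis (c * x)) = (cis (c * l) - 1) / (\<i> * c)"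
proof -
  have m: "(\<lambda>x. cis (c * x)) \<in> borel_measurable (lebesgue_on {0..l})" by measurable
  have "integral\<^sup>L (lebesgue_on {0..l}) (\<lambda>x. cis (c * x)) = integral {0..l} (\<lambda>x. cis (c * x))"
    by (rule lebesgue_integral_eq_integral) (auto intro!: integrable_bounded_interval[of _ _ _ 1] m)
  also have "((\<lambda>x. cis (c * x)) has_integral (cis (c * l) / (\<i> * c) - cis (c * 0) / (\<i> * c))) {0..l}"
  proof (rule fundamental_theorem_of_calculus[OF assms(2)])
    fix x assume "x \<in> {0..l}"
    show "((\<lambda>x. cis (c * x) / (\<i> * c)) has_vector_derivative cis (c * x)) (at x within {0..l})"
      unfolding cis_conv_exp
      by (rule has_vector_derivative_real_field derivative_eq_intros exp_scaleR_has_vector_derivative_left refl | simp)+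
         (use assms(1) in \<open>auto simp: scaleR_conv_of_real field_simps\<close>)
  qed
  then have "integral {0..l} (\<lambda>x. cis (c * x)) = (cis (c * l) / (\<i> * c) - cis (c * 0) / (\<i> * c))"
    by (rule integral_unique)
  also have "\<dots> = (cis (c * l) - 1) / (\<i> * c)" by (simp add: diff_divide_distrib)
  finally show ?thesis .
qed

lemma integral_cis_period:
  assumes "L > 0"
  shows "integral\<^sup>L (torus L) (\<lambda>x. cis (2 * pi * of_int n / L * x)) = (if n = 0 then of_real L else 0)"
proof (cases "n = 0")
  case True
  then show ?thesis using assms by (simp add: measure_restrict_space scaleR_conv_of_real)
next
  case False
  have "2 * pi * of_int n / L * L = 2 * pi * of_int n" using assms by simp
  then have "cis (2 * pi * of_int n / L * L) = 1" by (simp add: cis_multiple_2pi)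
  then show ?thesis using integral_cis[of "2 * pi * of_int n / L" L] False assms by simp
qed

lemma phase_integral_0 [simp]: "phase_integral L 0 = 1"
  by (simp add: phase_integral_def measure_restrict_space)

text \<open>For a nonzero frequency the primitive leaves boundary terms of modulus at most 2,
  divided by that frequency.\<close>

lemma norm_phase_integral_le_inverse:
  assumes "L > 0" "n \<noteq> 0"
  shows "cmod (phase_integral L n) \<le> L\<^sup>2 / (4 * pi\<^sup>2) * (1 / real_of_int \<bar>n\<bar>)"
proof -
  let ?c = "8 * pi\<^sup>2 * of_int n / L\<^sup>2"
  have c: "?c \<noteq> 0" using assms by simp
  have "phase_integral L n = (cis (?c * 1) - 1) / (\<i> * complex_of_real ?c)"
    unfolding phase_integral_def by (rule integral_cis[OF c]) simp
  then have "cmod (phase_integral L n) = cmod (cis ?c - 1) / \<bar>?c\<bar>"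
    by (simp only: norm_divide norm_mult norm_ii norm_of_real mult_1_right mult_1_left)
  also have "\<dots> \<le> 2 / \<bar>?c\<bar>"
    using norm_triangle_ineq4[of "cis ?c" 1] by (intro divide_right_mono) auto
  also have "\<dots> = L\<^sup>2 / (4 * pi\<^sup>2) * (1 / real_of_int \<bar>n\<bar>)" using assms by (simp add: abs_mult field_simps)
  finally show ?thesis .
qed

lemma norm_cis_minus_1_le: "cmod (cis t - 1) \<le> \<bar>t\<bar>"
  using dist_exp_i_1[of t] abs_sin_x_le_abs_x[of "t / 2"] by (simp add: cis_conv_exp)

text \<open>Over unit time the phase turns by at most its frequency. For a few low modes and large
  \<open>L\<close> nonresonant interactions are thus almost as strong as resonant ones, which drives
  the lower bound on \<open>omega1\<close>.\<close>

lemma norm_phase_integral_diff_1: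
  assumes "L > 0"
  shows "cmod (phase_integral L n - 1) \<le> 8 * pi\<^sup>2 * \<bar>of_int n\<bar> / L\<^sup>2"
proof -
  let ?c = "8 * pi\<^sup>2 * of_int n / L\<^sup>2"
  have m: "integrable time (\<lambda>r. cis (?c * r))"
    by (rule integrable_bounded_interval[of _ _ _ 1]) (auto)
  have "phase_integral L n - 1 = integral\<^sup>L time (\<lambda>r. cis (?c * r) - 1)"
    using m by (simp add: phase_integral_def measure_restrict_space)
  also have "cmod \<dots> \<le> integral\<^sup>L time (\<lambda>r. cmod (cis (?c * r) - 1))" by (rule integral_norm_bound)
  also have "\<dots> \<le> integral\<^sup>L time (\<lambda>r. \<bar>?c\<bar>)"
  proof (rule integral_mono)
    show "integrable time (\<lambda>r. cmod (cis (?c * r) - 1))" using m by auto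
    fix r assume "r \<in> space time"
    then have r: "0 \<le> r" "r \<le> 1" by auto
    have "cmod (cis (?c * r) - 1) \<le> \<bar>?c * r\<bar>" by (rule norm_cis_minus_1_le)
    also have "\<dots> \<le> \<bar>?c\<bar>" using mult_left_mono[OF r(2), of "\<bar>?c\<bar>"] r(1)
      by (simp only: abs_mult[of ?c r] abs_of_nonneg mult_1_right abs_ge_zero)
    finally show "cmod (cis (?c * r) - 1) \<le> \<bar>?c\<bar>" .
  qed auto
  also have "\<dots> = 8 * pi\<^sup>2 * \<bar>of_int n\<bar> / L\<^sup>2" by (simp add: measure_restrict_space abs_mult)
  finally show ?thesis .
qed

lemma norm_mode: "L > 0 \<Longrightarrow> cmod (mode L k r x) = 1 / sqrt L"
  by (simp add: mode_def norm_mult norm_divide)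

lemma mode_periodic: "L > 0 \<Longrightarrow> mode L k r (x + L) = mode L k r x"
proof -
  assume L: "L > 0"
  define \<theta> where "\<theta> = 2 * pi * of_int k * x / L - 4 * pi\<^sup>2 * (of_int k)\<^sup>2 * r / L\<^sup>2"
  have "2 * pi * of_int k * (x + L) / L = 2 * pi * of_int k * x / L + 2 * pi * of_int k"
    using L by (simp add: field_simps)
  then have "2 * pi * of_int k * (x + L) / L - 4 * pi\<^sup>2 * (of_int k)\<^sup>2 * r / L\<^sup>2 = \<theta> + 2 * pi * of_int k"
    unfolding \<theta>_def by linarith
  then have "mode L k r (x + L) = of_real (1 / sqrt L) * (cis \<theta> * cis (2 * pi * of_int k))"
    unfolding mode_def cis_mult by (simp only:)
  then show ?thesis by (simp add: cis_multiple_2pi mode_def \<theta>_def)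
qed

lemma torus_char_mode: "torus_char L (- of_int k * x) = cnj (mode L k 0 x)"
proof -
  have "torus_char L y = of_real (1 / sqrt L) * cis (2 * pi * y / L)" for y
    by (simp add: torus_char_def cis_conv_exp mult_ac)
  then show ?thesis by (simp add: mode_def cis_cnj mult_ac)
qed

lemma torus_fourier_mode: "torus_fourier L f k = integral\<^sup>L (torus L) (\<lambda>x. f x * cnj (mode L k 0 x))"
  by (simp only: torus_fourier_def set_lebesgue_integral_lebesgue_on torus_char_mode)

lemma exp_phase:
  fixes r L :: real
  shows "exp (- (complex_of_real (4 * pi\<^sup>2) * \<i> * (complex_of_int k)\<^sup>2 * complex_of_real r / (complex_of_real L)\<^sup>2)) = cis (- (4 * pi\<^sup>2 * (of_int k)\<^sup>2 * r / L\<^sup>2))"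
  by (simp add: cis_conv_exp mult_ac)

lemma mode_measurable [measurable (raw)]:
  assumes "f \<in> borel_measurable M" "g \<in> borel_measurable M"
  shows "(\<lambda>w. mode L k (f w) (g w)) \<in> borel_measurable M"
  using assms unfolding mode_def by measurable

text \<open>Distinct frequencies are orthogonal at any pair of times. The choice
  \<open>s = 0\<close> yields Fourier coefficients of evolved data, \<open>s = r\<close>
  conservation of mass.\<close>

lemma mode_inner: 
  assumes "L > 0"
  shows "integral\<^sup>L (torus L) (\<lambda>x. mode L j r x * cnj (mode L k s x)) =
    (if j = k then cis (4 * pi\<^sup>2 * (of_int k)\<^sup>2 * (s - r) / L\<^sup>2) else 0)"
proof -
  define \<theta> where "\<theta> = 4 * pi\<^sup>2 * (of_int k)\<^sup>2 * s / L\<^sup>2 - 4 * pi\<^sup>2 * (of_int j)\<^sup>2 * r / L\<^sup>2"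
  have "mode L j r x * cnj (mode L k s x) = (of_real (1 / L) * cis \<theta>) * cis (2 * pi * of_int (j - k) / L * x)" for x
  proof -
    have "mode L j r x * cnj (mode L k s x) = of_real (1 / (sqrt L * sqrt L)) *
       (cis (2 * pi * of_int j * x / L - 4 * pi\<^sup>2 * (of_int j)\<^sup>2 * r / L\<^sup>2) *
        cis (- (2 * pi * of_int k * x / L - 4 * pi\<^sup>2 * (of_int k)\<^sup>2 * s / L\<^sup>2)))"
      by (simp add: mode_def cis_cnj mult_ac flip: of_real_mult)
    also have "\<dots> = of_real (1 / L) * cis (\<theta> + 2 * pi * of_int (j - k) / L * x)"
      unfolding cis_mult using assms by (simp add: \<theta>_def diff_divide_distrib algebra_simps)
    finally show ?thesis by (simp add: cis_mult)
  qed
  then have "integral\<^sup>L (torus L) (\<lambda>x. mode L j r x * cnj (mode L k s x)) =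
     (of_real (1 / L) * cis \<theta>) * integral\<^sup>L (torus L) (\<lambda>x. cis (2 * pi * of_int (j - k) / L * x))"
    by (simp only: integral_mult_right_zero)
  then show ?thesis unfolding integral_cis_period[OF assms]
    using assms by (auto simp: \<theta>_def diff_divide_distrib algebra_simps)
qed

section \<open>Square integrable periodic functions and their Fourier coefficients\<close>

lemma torus_L2_measurable: "f \<in> torus_L2 L \<Longrightarrow> f \<in> borel_measurable (lebesgue_on {a..b})"
  unfolding torus_L2_def by (auto intro: measurable_restrict_space1)

lemma torus_L2_square_integrable: "f \<in> torus_L2 L \<Longrightarrow> integrable (torus L) (\<lambda>x. (cmod (f x))\<^sup>2)"
  by (simp add: torus_L2_def set_integrable_lebesgue_on)

lemma torus_L2_integrable:
  assumes "f \<in> torus_L2 L"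
  shows "integrable (torus L) f"
proof (rule Bochner_Integration.integrable_bound[where f = "\<lambda>x. 1 + (cmod (f x))\<^sup>2"])
  interpret finite_measure "torus L" by (rule finite_measure_interval)
  show "integrable (torus L) (\<lambda>x. 1 + (cmod (f x))\<^sup>2)"
    using torus_L2_square_integrable[OF assms] by simp
  have "t \<le> 1 + t\<^sup>2" for t :: real
    using zero_le_power2[of "t - 1 / 2"] by (simp add: power2_eq_square algebra_simps)
  then show "AE x in torus L. cmod (f x) \<le> norm (1 + (cmod (f x))\<^sup>2)" by simp
qed (use torus_L2_measurable[OF assms] in auto)

text \<open>Every point is moved into \<open>{0..L}\<close> by a multiple of the period, so
  countably many translates of one null set cover the exceptional set.\<close>

lemma AE_periodic_eq:
  assumes L: "L > 0" and per: "periodic L f" "periodic L g"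
    and ae: "AE x in torus L. f x = g x"
  shows "AE x in lebesgue. f x = g x"
proof -
  have "AE x in lebesgue. x \<in> {0..L} \<longrightarrow> f x = g x"
    using ae by (subst (asm) AE_restrict_space_iff) auto
  then obtain N where N: "N \<in> null_sets lebesgue" "{x. \<not> (x \<in> {0..L} \<longrightarrow> f x = g x)} \<subseteq> N"
    unfolding eventually_ae_filter by auto
  have shift_nat: "h (x + of_nat n * L) = h x" if "periodic L h" for h :: "real \<Rightarrow> complex" and x n
  proof (induction n)
    case (Suc n)
    have "h (x + of_nat (Suc n) * L) = h ((x + of_nat n * L) + L)" by (simp add: algebra_simps)
    then show ?case using that Suc unfolding periodic_def by metis
  qed simp
  have shift: "h (x + of_int n * L) = h x" if "periodic L h" for h :: "real \<Rightarrow> complex" and x n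
  proof (cases "n \<ge> 0")
    case True
    then show ?thesis using shift_nat[OF that, of x "nat n"] by simp
  next
    case False
    then show ?thesis using shift_nat[OF that, of "x + of_int n * L" "nat (- n)"] by simp
  qed
  have neg: "negligible N" using N(1) by (simp add: negligible_iff_null_sets)
  have "negligible (\<Union>n::int. (+) (of_int n * L) ` N)"
    by (intro negligible_countable_Union) (auto intro: negligible_translation[OF neg])
  moreover have "{x. f x \<noteq> g x} \<subseteq> (\<Union>n::int. (+) (of_int n * L) ` N)"
  proof
    fix x assume x: "x \<in> {x. f x \<noteq> g x}"
    define n where "n = \<lfloor>x / L\<rfloor>"
    define y where "y = x + of_int (- n) * L"
    have "of_int n \<le> x / L" "x / L < of_int n + 1" unfolding n_def by linarith+
    then have "0 \<le> y" "y \<le> L" using L by (auto simp: y_def field_simps)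
    moreover have "f y = f x" "g y = g x" using shift per by (auto simp: y_def simp del: of_int_minus)
    ultimately have "y \<in> N" using N(2) x by auto
    then show "x \<in> (\<Union>n::int. (+) (of_int n * L) ` N)"
      by (intro UN_I[of n]) (auto simp: image_iff y_def intro!: bexI[of _ y])
  qed
  ultimately have "negligible {x. f x \<noteq> g x}" using negligible_subset by blast
  then have "{x. f x \<noteq> g x} \<in> null_sets lebesgue" by (simp add: negligible_iff_null_sets)
  from AE_not_in[OF this] show ?thesis by simp
qed

lemma integrable_mult_bounded:
  fixes f g :: "real \<Rightarrow> complex"
  assumes "integrable M f" "g \<in> borel_measurable M" "\<And>x. cmod (g x) \<le> B"
  shows "integrable M (\<lambda>x. f x * g x)"
proof (rule Bochner_Integration.integrable_bound[where f = "\<lambda>x. B * cmod (f x)"])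
  show "AE x in M. cmod (f x * g x) \<le> norm (B * cmod (f x))"
    using assms(3) by (intro AE_I2) (metis abs_ge_self mult.commute mult_left_mono norm_ge_zero norm_mult order_trans real_norm_def)
qed (use assms in auto)

text \<open>This turns the choice in \<open>schroedinger\<close> into a definite function up to null
  sets.\<close>

lemma torus_fourier_unique:
  assumes L: "L > 0" and fg: "f \<in> torus_L2 L" "g \<in> torus_L2 L"
    and eq: "\<And>k. torus_fourier L f k = torus_fourier L g k"
  shows "AE x in lebesgue. f x = g x"
proof (rule AE_periodic_eq[OF L])
  show "periodic L f" "periodic L g" using fg by (auto simp: torus_L2_def)
  note int = torus_L2_integrable[OF fg(1)] torus_L2_integrable[OF fg(2)]
  have "AE x in torus L. f x - g x = 0"
  proof (rule torus_fourier_unique_L1[OF L])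
    show "integrable (torus L) (\<lambda>x. f x - g x)" using int by simp
    fix k :: int
    have cis: "cis (of_int k * (2 * pi * x / L)) = of_real (sqrt L) * cnj (mode L (- k) 0 x)" for x
      using L by (simp add: mode_def cis_cnj mult_ac)
    have i: "integrable (torus L) (\<lambda>x. h x * cnj (mode L (- k) 0 x))" if "integrable (torus L) h" for h
      by (rule integrable_mult_bounded[OF that, of _ "1 / sqrt L"]) (auto simp: norm_mode[OF L])
    have "integral\<^sup>L (torus L) (\<lambda>x. (f x - g x) * cis (of_int k * (2 * pi * x / L))) =
       integral\<^sup>L (torus L) (\<lambda>x. of_real (sqrt L) * (f x * cnj (mode L (- k) 0 x) - g x * cnj (mode L (- k) 0 x)))"
      unfolding cis by (simp add: algebra_simps)
    also have "\<dots> = of_real (sqrt L) * (torus_fourier L f (- k) - torus_fourier L g (- k))"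
      unfolding torus_fourier_mode using i int by simp
    finally show "integral\<^sup>L (torus L) (\<lambda>x. (f x - g x) * cis (of_int k * (2 * pi * x / L))) = 0"
      by (simp add: eq)
  qed
  then show "AE x in torus L. f x = g x" by simp
qed

section \<open>Finite Fourier sums under the free flow, Parseval and Bessel\<close>

definition evolve :: "real \<Rightarrow> int set \<Rightarrow> (int \<Rightarrow> complex) \<Rightarrow> real \<Rightarrow> real \<Rightarrow> complex" where
  "evolve L F a r x = (\<Sum>k\<in>F. a k * mode L k r x)"

lemma evolve_measurable [measurable (raw)]:
  assumes "f \<in> borel_measurable M" "g \<in> borel_measurable M"
  shows "(\<lambda>w. evolve L F a (f w) (g w)) \<in> borel_measurable M"
  using assms unfolding evolve_def by measurable

lemma norm_evolve_le:
  assumes "L > 0"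
  shows "cmod (evolve L F a r x) \<le> (\<Sum>k\<in>F. cmod (a k)) / sqrt L"
  unfolding evolve_def using assms
  by (auto intro!: order_trans[OF norm_sum] simp: norm_mult norm_mode sum_divide_distrib)

lemma integrable_evolve_mode:
  assumes "L > 0"
  shows "integrable (torus L) (\<lambda>x. mode L j r x * cnj (mode L k s x))"
  using assms by (intro integrable_bounded_interval[of _ _ _ "1 / sqrt L * (1 / sqrt L)"])
    (auto simp: norm_mult norm_mode)

lemma evolve_fourier:
  assumes L: "L > 0" and F: "finite F"
  shows "integral\<^sup>L (torus L) (\<lambda>x. evolve L F a r x * cnj (mode L k 0 x)) =
    (if k \<in> F then cis (- (4 * pi\<^sup>2 * (of_int k)\<^sup>2 * r / L\<^sup>2)) * a k else 0)"
proof -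
  have "integral\<^sup>L (torus L) (\<lambda>x. evolve L F a r x * cnj (mode L k 0 x)) =
     integral\<^sup>L (torus L) (\<lambda>x. \<Sum>j\<in>F. a j * (mode L j r x * cnj (mode L k 0 x)))"
    by (simp add: evolve_def sum_distrib_right mult.assoc)
  also have "\<dots> = (\<Sum>j\<in>F. a j * integral\<^sup>L (torus L) (\<lambda>x. mode L j r x * cnj (mode L k 0 x)))"
    using integrable_evolve_mode[OF L] by simp
  also have "\<dots> = (\<Sum>j\<in>F. if j = k then cis (- (4 * pi\<^sup>2 * (of_int k)\<^sup>2 * r / L\<^sup>2)) * a k else 0)"
    unfolding mode_inner[OF L] by (intro sum.cong) auto
  also have "\<dots> = (if k \<in> F then cis (- (4 * pi\<^sup>2 * (of_int k)\<^sup>2 * r / L\<^sup>2)) * a k else 0)"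
    using F by simp
  finally show ?thesis .
qed

lemma evolve_L2:
  assumes L: "L > 0" and F: "finite F"
  shows "integral\<^sup>L (torus L) (\<lambda>x. (cmod (evolve L F a r x))\<^sup>2) = (\<Sum>k\<in>F. (cmod (a k))\<^sup>2)"
proof -
  have "complex_of_real (integral\<^sup>L (torus L) (\<lambda>x. (cmod (evolve L F a r x))\<^sup>2)) =
     integral\<^sup>L (torus L) (\<lambda>x. evolve L F a r x * cnj (evolve L F a r x))"
    unfolding integral_complex_of_real[symmetric] by (simp only: complex_norm_square)
  also have "\<dots> = integral\<^sup>L (torus L) (\<lambda>x. \<Sum>(j,k)\<in>F \<times> F. (a j * cnj (a k)) * (mode L j r x * cnj (mode L k r x)))"
    by (simp add: evolve_def sum_product sum.cartesian_product mult_ac)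
  also have "\<dots> = (\<Sum>(j,k)\<in>F \<times> F. (a j * cnj (a k)) * integral\<^sup>L (torus L) (\<lambda>x. mode L j r x * cnj (mode L k r x)))"
    using integrable_evolve_mode[OF L] by (simp add: case_prod_beta)
  also have "\<dots> = (\<Sum>j\<in>F. \<Sum>k\<in>F. if j = k then a j * cnj (a k) else 0)"
    unfolding mode_inner[OF L] sum.cartesian_product by (intro sum.cong) auto
  also have "\<dots> = complex_of_real (\<Sum>k\<in>F. (cmod (a k))\<^sup>2)" using F by (simp add: complex_norm_square del: of_real_power)
  finally show ?thesis by (simp only: of_real_eq_iff)
qed

text \<open>The square distance from \<open>f\<close> to its finite Fourier sum is nonnegative, and
  in its expansion the cross integral equals the square norm of that sum.\<close>

lemma bessel:
  assumes L: "L > 0" and f: "f \<in> torus_L2 L" and F: "finite F"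
  shows "(\<Sum>k\<in>F. (cmod (torus_fourier L f k))\<^sup>2) \<le> integral\<^sup>L (torus L) (\<lambda>x. (cmod (f x))\<^sup>2)"
proof -
  define c where "c = torus_fourier L f"
  let ?P = "\<lambda>x. evolve L F c 0 x"
  have [measurable]: "f \<in> borel_measurable (torus L)" using f by (rule torus_L2_measurable)
  have i1: "integrable (torus L) (\<lambda>x. f x * cnj (mode L k 0 x))" for k
    by (rule integrable_mult_bounded[OF torus_L2_integrable[OF f], of _ "1 / sqrt L"]) (auto simp: norm_mode[OF L])
  have i2: "integrable (torus L) (\<lambda>x. f x * cnj (?P x))"
    by (rule integrable_mult_bounded[OF torus_L2_integrable[OF f], of _ "(\<Sum>k\<in>F. cmod (c k)) / sqrt L"])
       (simp_all add: norm_evolve_le[OF L])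
  have i3: "integrable (torus L) (\<lambda>x. (cmod (?P x))\<^sup>2)"
  proof (rule finite_measure.integrable_const_bound[OF finite_measure_interval, of _ "((\<Sum>k\<in>F. cmod (c k)) / sqrt L)\<^sup>2"])
    show "AE x in torus L. norm ((cmod (?P x))\<^sup>2) \<le> ((\<Sum>k\<in>F. cmod (c k)) / sqrt L)\<^sup>2"
      using norm_evolve_le[OF L, of F c 0] by (intro AE_I2) (auto intro!: power_mono)
  qed measurable
  have "integral\<^sup>L (torus L) (\<lambda>x. f x * cnj (?P x)) =
      integral\<^sup>L (torus L) (\<lambda>x. \<Sum>k\<in>F. cnj (c k) * (f x * cnj (mode L k 0 x)))"
    by (simp add: evolve_def sum_distrib_left mult_ac)
  also have "\<dots> = (\<Sum>k\<in>F. cnj (c k) * c k)" using i1 by (simp add: c_def torus_fourier_mode)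
  also have "\<dots> = complex_of_real (\<Sum>k\<in>F. (cmod (c k))\<^sup>2)"
    by (simp add: complex_norm_square mult.commute del: of_real_power)
  finally have cross: "integral\<^sup>L (torus L) (\<lambda>x. f x * cnj (?P x)) = complex_of_real (\<Sum>k\<in>F. (cmod (c k))\<^sup>2)" .
  have "0 \<le> integral\<^sup>L (torus L) (\<lambda>x. (cmod (f x - ?P x))\<^sup>2)" by simp
  also have "(\<lambda>x. (cmod (f x - ?P x))\<^sup>2) = (\<lambda>x. (cmod (f x))\<^sup>2 - 2 * Re (f x * cnj (?P x)) + (cmod (?P x))\<^sup>2)"
  proof
    have "(cmod (z - w))\<^sup>2 = (cmod z)\<^sup>2 - 2 * Re (z * cnj w) + (cmod w)\<^sup>2" for z w
      unfolding cmod_power2 by (simp add: power2_eq_square algebra_simps)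
    then show "(cmod (f x - ?P x))\<^sup>2 = (cmod (f x))\<^sup>2 - 2 * Re (f x * cnj (?P x)) + (cmod (?P x))\<^sup>2" for x .
  qed
  also have "integral\<^sup>L (torus L) \<dots> = integral\<^sup>L (torus L) (\<lambda>x. (cmod (f x))\<^sup>2) -
      2 * Re (integral\<^sup>L (torus L) (\<lambda>x. f x * cnj (?P x))) + integral\<^sup>L (torus L) (\<lambda>x. (cmod (?P x))\<^sup>2)"
  proof -
    define h where "h = (\<lambda>x. f x * cnj (?P x))"
    have fold: "f x * cnj (?P x) = h x" for x by (simp add: h_def)
    have "integrable (torus L) h" using i2 by (simp add: h_def)
    then have "integrable (torus L) (\<lambda>x. Re (h x))" "integral\<^sup>L (torus L) (\<lambda>x. Re (h x)) = Re (integral\<^sup>L (torus L) h)"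
      by auto
    then show ?thesis
      using i3 torus_L2_square_integrable[OF f] unfolding fold by simp
  qed
  also have "\<dots> = integral\<^sup>L (torus L) (\<lambda>x. (cmod (f x))\<^sup>2) - (\<Sum>k\<in>F. (cmod (c k))\<^sup>2)"
    unfolding cross evolve_L2[OF L F] by simp
  finally show ?thesis by (simp add: c_def)
qed

lemma torus_norm_eq: "torus_norm L f = sqrt (integral\<^sup>L (torus L) (\<lambda>x. (cmod (f x))\<^sup>2))"
proof -
  have "torus_inner L f f = integral\<^sup>L (torus L) (\<lambda>x. complex_of_real ((cmod (f x))\<^sup>2))"
    by (simp add: torus_inner_def set_lebesgue_integral_lebesgue_on complex_norm_square mult.commute del: of_real_power)
  then have "torus_inner L f f = complex_of_real (integral\<^sup>L (torus L) (\<lambda>x. (cmod (f x))\<^sup>2))"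
    by (simp only: integral_complex_of_real)
  then show ?thesis by (simp add: torus_norm_def)
qed

lemma torus_norm_square: "(torus_norm L f)\<^sup>2 = integral\<^sup>L (torus L) (\<lambda>x. (cmod (f x))\<^sup>2)"
  by (simp add: torus_norm_eq)

section \<open>The quartic form on trigonometric polynomials\<close>

text \<open>For \<open>k\<close> in \<open>F\<close> this is \<open>L\<close> times the
  \<open>k\<close>-th Fourier coefficient of Q(f, f, f), where f has coefficients \<open>a\<close>
  on \<open>F\<close>. Momentum conservation has already removed the conjugated frequency.\<close>

definition cubic :: "real \<Rightarrow> int set \<Rightarrow> (int \<Rightarrow> complex) \<Rightarrow> int \<Rightarrow> complex" where
  "cubic L F a k = (\<Sum>l\<in>F. \<Sum>m\<in>F. if l + m - k \<in> F
     then a l * cnj (a (l + m - k)) * a m * phase_integral L ((k - l) * (k - m)) else 0)"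

lemma pair_sigma_finite_spacetime: "pair_sigma_finite time (torus L)"
  by (intro pair_sigma_finite.intro finite_measure.axioms(1) finite_measure_interval)

lemma finite_measure_spacetime: "finite_measure (time \<Otimes>\<^sub>M torus L)"
  by (intro finite_measure_pair_measure finite_measure_interval)

lemma fst_measurable_spacetime [measurable]: "fst \<in> borel_measurable (lebesgue_on S \<Otimes>\<^sub>M M)"
  for S :: "real set"
  by (rule measurable_compose[OF measurable_fst borel_measurable_ident_lebesgue_on])

lemma snd_measurable_spacetime [measurable]: "snd \<in> borel_measurable (M \<Otimes>\<^sub>M lebesgue_on S)"
  for S :: "real set"
  by (rule measurable_compose[OF measurable_snd borel_measurable_ident_lebesgue_on])

lemma integrable_spacetime_bounded:
  fixes f :: "real \<times> real \<Rightarrow> 'a::{banach, second_countable_topology}"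
  assumes "f \<in> borel_measurable (time \<Otimes>\<^sub>M torus L)" "\<And>w. norm (f w) \<le> B"
  shows "integrable (time \<Otimes>\<^sub>M torus L) f"
  by (rule finite_measure.integrable_const_bound[OF finite_measure_spacetime, of _ B]) (use assms in auto)

definition mode4 :: "real \<Rightarrow> int \<Rightarrow> int \<Rightarrow> int \<Rightarrow> int \<Rightarrow> real \<times> real \<Rightarrow> complex" where
  "mode4 L k l n m = (\<lambda>w. cnj (mode L k (fst w) (snd w)) * mode L l (fst w) (snd w) *
     cnj (mode L n (fst w) (snd w)) * mode L m (fst w) (snd w))"

lemma integrable_mode4:
  assumes "L > 0"
  shows "integrable (time \<Otimes>\<^sub>M torus L) (mode4 L k l n m)"
  unfolding mode4_def
  by (rule integrable_spacetime_bounded[of _ _ "1 / sqrt L * (1 / sqrt L) * (1 / sqrt L) * (1 / sqrt L)"])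
     (use assms in \<open>auto simp: norm_mult norm_mode\<close>)

text \<open>The space integral forces \<open>n = l + m - k\<close> and contributes \<open>L\<close>,
  against \<open>1 / L^2\<close> from the four normalisations. Under this constraint the time
  frequency factorises.\<close>

lemma mode4_integral:
  assumes L: "L > 0"
  shows "integral\<^sup>L (time \<Otimes>\<^sub>M torus L) (mode4 L k l n m) =
    (if n = l + m - k then of_real (1 / L) * phase_integral L ((k - l) * (k - m)) else 0)"
proof -
  interpret pair_sigma_finite time "torus L" by (rule pair_sigma_finite_spacetime)
  define \<alpha> where "\<alpha> = 4 * pi\<^sup>2 * ((of_int k)\<^sup>2 - (of_int l)\<^sup>2 + (of_int n)\<^sup>2 - (of_int m)\<^sup>2) / L\<^sup>2"
  have form: "mode4 L k l n m (r, x) = (of_real (1 / L\<^sup>2) * cis (\<alpha> * r)) * cis (2 * pi * of_int (l + m - k - n) / L * x)" for r x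
  proof -
    define p where "p = (\<lambda>j::int. 2 * pi * of_int j * x / L - 4 * pi\<^sup>2 * (of_int j)\<^sup>2 * r / L\<^sup>2)"
    have "mode4 L k l n m (r, x) = of_real (1 / sqrt L * (1 / sqrt L) * (1 / sqrt L * (1 / sqrt L))) *
        (cis (- p k) * cis (p l) * cis (- p n) * cis (p m))"
      by (simp only: mode4_def mode_def p_def cis_cnj complex_cnj_mult complex_cnj_complex_of_real
          of_real_mult fst_conv snd_conv mult_ac)
    also have "1 / sqrt L * (1 / sqrt L) * (1 / sqrt L * (1 / sqrt L)) = 1 / L\<^sup>2"
      using L by (simp add: power2_eq_square)
    also have "cis (- p k) * cis (p l) * cis (- p n) * cis (p m) =
        cis (\<alpha> * r + 2 * pi * of_int (l + m - k - n) / L * x)"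
      unfolding cis_mult \<alpha>_def p_def by (rule arg_cong[of _ _ cis]) (simp add: add_divide_distrib diff_divide_distrib algebra_simps)
    finally show ?thesis by (simp only: cis_mult[symmetric] mult.assoc)
  qed
  have "integral\<^sup>L (time \<Otimes>\<^sub>M torus L) (mode4 L k l n m) =
      integral\<^sup>L time (\<lambda>r. integral\<^sup>L (torus L) (\<lambda>x. mode4 L k l n m (r, x)))"
    by (rule integral_fst'[symmetric, OF integrable_mode4[OF L]])
  also have "\<dots> = integral\<^sup>L time (\<lambda>r. (of_real (1 / L\<^sup>2) * cis (\<alpha> * r)) * (if l + m - k - n = 0 then of_real L else 0))"
    unfolding form integral_mult_right_zero integral_cis_period[OF L] by (rule refl)
  also have "\<dots> = (if n = l + m - k then of_real (1 / L) * phase_integral L ((k - l) * (k - m)) else 0)"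
  proof (cases "n = l + m - k")
    case True
    have "(of_int k)\<^sup>2 - (of_int l)\<^sup>2 + (of_int n)\<^sup>2 - (of_int m)\<^sup>2 = 2 * (of_int ((k - l) * (k - m)) :: real)"
      unfolding True by (simp add: power2_eq_square algebra_simps)
    then have al: "\<alpha> = 8 * pi\<^sup>2 * of_int ((k - l) * (k - m)) / L\<^sup>2" unfolding \<alpha>_def by simp
    have "complex_of_real (1 / L\<^sup>2) * z * of_real L = of_real (1 / L) * z" for z
      using L by (simp add: power2_eq_square)
    then show ?thesis using True unfolding phase_integral_def al by simp
  next
    case False
    then have "l + m - k - n \<noteq> 0" by simp
    then show ?thesis using False by simp
  qed
  finally show ?thesis .
qed

lemma sum_times4:
  fixes h :: "'a \<Rightarrow> 'a \<Rightarrow> 'a \<Rightarrow> 'a \<Rightarrow> 'b::comm_monoid_add"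
  shows
  "(\<Sum>(p, q)\<in>(A \<times> A) \<times> (A \<times> A). h (fst p) (snd p) (fst q) (snd q)) =
   (\<Sum>k\<in>A. \<Sum>l\<in>A. \<Sum>n\<in>A. \<Sum>m\<in>A. h k l n m)"
proof -
  have "(\<Sum>q\<in>A \<times> A. g (fst q) (snd q)) = (\<Sum>n\<in>A. \<Sum>m\<in>A. g n m)" for g :: "'a \<Rightarrow> 'a \<Rightarrow> 'b"
    by (simp add: sum.cartesian_product case_prod_beta)
  then show ?thesis unfolding sum.cartesian_product[symmetric] by simp
qed

lemma evolve_quartic:
  assumes L: "L > 0" and F: "finite F"
  shows "integral\<^sup>L (time \<Otimes>\<^sub>M torus L) (\<lambda>w. cnj (evolve L F b (fst w) (snd w)) * evolve L F a (fst w) (snd w) *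
      cnj (evolve L F a (fst w) (snd w)) * evolve L F a (fst w) (snd w)) =
    of_real (1 / L) * (\<Sum>k\<in>F. cnj (b k) * cubic L F a k)"
proof -
  let ?P = "time \<Otimes>\<^sub>M torus L"
  define c where "c = (\<lambda>k l n m. cnj (b k) * a l * cnj (a n) * a m)"
  have expand: "cnj (evolve L F b r x) * evolve L F a r x * cnj (evolve L F a r x) * evolve L F a r x =
     (\<Sum>(p, q)\<in>(F \<times> F) \<times> (F \<times> F). c (fst p) (snd p) (fst q) (snd q) * mode4 L (fst p) (snd p) (fst q) (snd q) (r, x))" for r x
  proof -
    have 1: "cnj (evolve L F d r x) * evolve L F a r x =
      (\<Sum>p\<in>F \<times> F. (cnj (d (fst p)) * a (snd p)) * (cnj (mode L (fst p) r x) * mode L (snd p) r x))" for d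
      unfolding evolve_def cnj_sum sum_product sum.cartesian_product
      by (rule sum.cong) (auto simp: mult_ac)
    have "cnj (evolve L F b r x) * evolve L F a r x * cnj (evolve L F a r x) * evolve L F a r x =
       (cnj (evolve L F b r x) * evolve L F a r x) * (cnj (evolve L F a r x) * evolve L F a r x)"
      by (simp only: mult.assoc)
    also have "\<dots> = (\<Sum>(p, q)\<in>(F \<times> F) \<times> (F \<times> F). c (fst p) (snd p) (fst q) (snd q) * mode4 L (fst p) (snd p) (fst q) (snd q) (r, x))"
      unfolding 1 sum_product sum.cartesian_product
      by (rule sum.cong) (auto simp: c_def mode4_def mult_ac)
    finally show ?thesis .
  qed
  have "integral\<^sup>L ?P (\<lambda>w. cnj (evolve L F b (fst w) (snd w)) * evolve L F a (fst w) (snd w) *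
      cnj (evolve L F a (fst w) (snd w)) * evolve L F a (fst w) (snd w)) =
      (\<Sum>(p, q)\<in>(F \<times> F) \<times> (F \<times> F). c (fst p) (snd p) (fst q) (snd q) *
         integral\<^sup>L ?P (mode4 L (fst p) (snd p) (fst q) (snd q)))"
    unfolding expand prod.collapse case_prod_beta
    by (subst Bochner_Integration.integral_sum) (use integrable_mode4[OF L] in auto)
  also have "\<dots> = (\<Sum>k\<in>F. \<Sum>l\<in>F. \<Sum>n\<in>F. \<Sum>m\<in>F. c k l n m *
      (if n = l + m - k then of_real (1 / L) * phase_integral L ((k - l) * (k - m)) else 0))"
    unfolding mode4_integral[OF L] by (rule sum_times4)
  \<comment> \<open>The index \<open>n\<close> is moved to the innermost position, where the
    momentum constraint leaves at most one term.\<close>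
  also have "\<dots> = (\<Sum>k\<in>F. \<Sum>l\<in>F. \<Sum>m\<in>F. \<Sum>n\<in>F. c k l n m *
      (if n = l + m - k then of_real (1 / L) * phase_integral L ((k - l) * (k - m)) else 0))"
    by (intro sum.cong refl sum.swap)
  also have "\<dots> = (\<Sum>k\<in>F. \<Sum>l\<in>F. \<Sum>m\<in>F. if l + m - k \<in> F
      then c k l (l + m - k) m * (of_real (1 / L) * phase_integral L ((k - l) * (k - m))) else 0)"
  proof (intro sum.cong refl)
    fix k l m
    have "(\<Sum>n\<in>F. c k l n m * (if n = l + m - k then of_real (1 / L) * phase_integral L ((k - l) * (k - m)) else 0)) =
       (\<Sum>n\<in>F. if n = l + m - k then c k l n m * (of_real (1 / L) * phase_integral L ((k - l) * (k - m))) else 0)"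
      by (intro sum.cong) auto
    then show "(\<Sum>n\<in>F. c k l n m * (if n = l + m - k then of_real (1 / L) * phase_integral L ((k - l) * (k - m)) else 0)) =
       (if l + m - k \<in> F then c k l (l + m - k) m * (of_real (1 / L) * phase_integral L ((k - l) * (k - m))) else 0)"
      using F by simp
  qed
  also have "\<dots> = of_real (1 / L) * (\<Sum>k\<in>F. cnj (b k) * cubic L F a k)"
    unfolding cubic_def sum_distrib_left by (intro sum.cong refl) (auto simp: c_def)
  finally show ?thesis .
qed

section \<open>Separation of the resonant terms and the L^4 Strichartz estimate\<close>

definition truncated_norm :: "int set \<Rightarrow> (int \<Rightarrow> complex) \<Rightarrow> int \<Rightarrow> real" where
  "truncated_norm F a k = (if k \<in> F then cmod (a k) else 0)"

lemma norm_phase_integral_le_recip_abs: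
  assumes "L > 0" "p \<noteq> 0" "q \<noteq> 0"
  shows "cmod (phase_integral L (p * q)) \<le> L\<^sup>2 / (4 * pi\<^sup>2) * (recip_abs p * recip_abs q)"
  using norm_phase_integral_le_inverse[OF assms(1), of "p * q"] assms by (simp add: recip_abs_def abs_mult)

text \<open>Inclusion-exclusion over \<open>l = k\<close> and \<open>m = k\<close>: each condition
  contributes the full mass times \<open>a k\<close>, and \<open>l = m = k\<close> is counted twice.
  On these pairs the phase integral is 1. Since \<open>truncated_norm\<close> vanishes off
  \<open>F\<close>, \<open>trilinear\<close> carries the condition \<open>l + m - k \<in> F\<close>
  by itself.\<close>

lemma cubic_resonance:
  fixes a :: "int \<Rightarrow> complex"
  assumes L: "L > 0" and F: "finite F" and k: "k \<in> F"
  shows "cmod (cubic L F a k - (2 * (\<Sum>l\<in>F. (cmod (a l))\<^sup>2) - (cmod (a k))\<^sup>2) * a k)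
     \<le> L\<^sup>2 / (4 * pi\<^sup>2) * trilinear F recip_abs recip_abs (truncated_norm F a) k"
proof -
  define t where "t = (\<lambda>l m. if l + m - k \<in> F
     then a l * cnj (a (l + m - k)) * a m * phase_integral L ((k - l) * (k - m)) else 0)"
  define r where "r = (\<lambda>l m. if l = k \<or> m = k then 0 else t l m)"
  have pt: "t l m = ((if l = k then a k * (cmod (a m))\<^sup>2 else 0) + (if m = k then a k * (cmod (a l))\<^sup>2 else 0)
      - (if l = k then if m = k then a k * (cmod (a k))\<^sup>2 else 0 else 0)) + r l m" if "l \<in> F" "m \<in> F" for l m
    using that k by (auto simp: t_def r_def complex_norm_square mult_ac simp del: of_real_power)
  have "cubic L F a k = (\<Sum>l\<in>F. \<Sum>m\<in>F. t l m)" by (simp add: cubic_def t_def)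
  also have "\<dots> = (\<Sum>l\<in>F. \<Sum>m\<in>F. ((if l = k then a k * (cmod (a m))\<^sup>2 else 0) + (if m = k then a k * (cmod (a l))\<^sup>2 else 0)
      - (if l = k then if m = k then a k * (cmod (a k))\<^sup>2 else 0 else 0)) + r l m)"
    by (intro sum.cong refl pt)
  also have "\<dots> = ((\<Sum>m\<in>F. \<Sum>l\<in>F. if l = k then a k * (cmod (a m))\<^sup>2 else 0) + (\<Sum>l\<in>F. \<Sum>m\<in>F. if m = k then a k * (cmod (a l))\<^sup>2 else 0)
      - (\<Sum>l\<in>F. \<Sum>m\<in>F. if l = k then if m = k then a k * (cmod (a k))\<^sup>2 else 0 else 0)) + (\<Sum>l\<in>F. \<Sum>m\<in>F. r l m)"
    unfolding sum.distrib sum_subtractf by (subst sum.swap) (rule refl)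
  also have "(\<Sum>m\<in>F. \<Sum>l\<in>F. if l = k then a k * (cmod (a m))\<^sup>2 else 0) = (\<Sum>m\<in>F. (cmod (a m))\<^sup>2) * a k"
    using F k by (simp add: sum_distrib_left sum_distrib_right mult.commute)
  also have "(\<Sum>l\<in>F. \<Sum>m\<in>F. if l = k then if m = k then a k * (cmod (a k))\<^sup>2 else 0 else 0) = (cmod (a k))\<^sup>2 * a k"
  proof -
    have "(\<Sum>m\<in>F. if l = k then if m = k then a k * (cmod (a k))\<^sup>2 else 0 else 0) = (if l = k then a k * (cmod (a k))\<^sup>2 else 0)" for l
      using F k by (cases "l = k") auto
    then show ?thesis using F k by simp
  qed
  finally have "cubic L F a k - (2 * (\<Sum>l\<in>F. (cmod (a l))\<^sup>2) - (cmod (a k))\<^sup>2) * a k = (\<Sum>l\<in>F. \<Sum>m\<in>F. r l m)"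
    by (simp add: algebra_simps)
  also have "cmod \<dots> \<le> (\<Sum>l\<in>F. \<Sum>m\<in>F. cmod (r l m))" by (intro order_trans[OF norm_sum] sum_mono norm_sum)
  also have "\<dots> \<le> (\<Sum>l\<in>F. \<Sum>m\<in>F. L\<^sup>2 / (4 * pi\<^sup>2) * (recip_abs (k - l) * recip_abs (k - m) *
      (truncated_norm F a l * truncated_norm F a m * truncated_norm F a (l + m - k))))"
  proof (intro sum_mono)
    fix l m assume lm: "l \<in> F" "m \<in> F"
    show "cmod (r l m) \<le> L\<^sup>2 / (4 * pi\<^sup>2) * (recip_abs (k - l) * recip_abs (k - m) *
      (truncated_norm F a l * truncated_norm F a m * truncated_norm F a (l + m - k)))"
    proof (cases "l = k \<or> m = k \<or> l + m - k \<notin> F")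
      case True
      then have "r l m = 0" by (auto simp: r_def t_def)
      then show ?thesis by (auto simp: truncated_norm_def intro!: mult_nonneg_nonneg divide_nonneg_nonneg)
    next
      case False
      then have "cmod (r l m) = cmod (phase_integral L ((k - l) * (k - m))) * (cmod (a l) * cmod (a m) * cmod (a (l + m - k)))"
        by (simp add: r_def t_def norm_mult)
      also have "\<dots> \<le> (L\<^sup>2 / (4 * pi\<^sup>2) * (recip_abs (k - l) * recip_abs (k - m))) * (cmod (a l) * cmod (a m) * cmod (a (l + m - k)))"
        by (intro mult_right_mono norm_phase_integral_le_recip_abs L) (use False in auto)
      finally show ?thesis using False lm by (simp add: truncated_norm_def mult.assoc)
    qed
  qed
  also have "\<dots> = L\<^sup>2 / (4 * pi\<^sup>2) * trilinear F recip_abs recip_abs (truncated_norm F a) k"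
    by (simp add: trilinear_def sum_distrib_left sum.cartesian_product case_prod_beta)
  finally show ?thesis .
qed

text \<open>The 3 bounds the resonant factor \<open>2 * S - |a k|^2\<close> in units of the mass
  \<open>S\<close>; \<open>L^2 / pi^2\<close> is the phase constant \<open>L^2 / (4 * pi^2)\<close>
  times 4, since each of the two kernels has l^2 norm at most 2.\<close>

definition strichartz_const :: "real \<Rightarrow> real" where
  "strichartz_const L = (3 + L\<^sup>2 / pi\<^sup>2) / L"

lemma truncated_norm_sum_le:
  assumes F: "finite F" and S: "finite S"
  shows "(\<Sum>k\<in>S. (truncated_norm F a k)\<^sup>2) \<le> (\<Sum>k\<in>F. (cmod (a k))\<^sup>2)"
proof -
  have "(\<Sum>k\<in>S. (truncated_norm F a k)\<^sup>2) = (\<Sum>k\<in>S \<inter> F. (truncated_norm F a k)\<^sup>2)"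
    using S by (intro sum.mono_neutral_right) (auto simp: truncated_norm_def)
  also have "\<dots> = (\<Sum>k\<in>S \<inter> F. (cmod (a k))\<^sup>2)" by (intro sum.cong) (auto simp: truncated_norm_def)
  also have "\<dots> \<le> (\<Sum>k\<in>F. (cmod (a k))\<^sup>2)" by (rule sum_mono2) (use F in auto)
  finally show ?thesis .
qed

lemma strichartz_bound:
  assumes L: "L > 0" and F: "finite F"
  shows "cmod (of_real (1 / L) * (\<Sum>k\<in>F. cnj (a k) * cubic L F a k))
     \<le> strichartz_const L * (\<Sum>k\<in>F. (cmod (a k))\<^sup>2)\<^sup>2"
proof -
  define S where "S = (\<Sum>k\<in>F. (cmod (a k))\<^sup>2)"
  have S0: "S \<ge> 0" by (simp add: S_def sum_nonneg)
  define T where "T = (\<lambda>k. trilinear F recip_abs recip_abs (truncated_norm F a) k)"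
  have T0: "T k \<ge> 0" for k
    unfolding T_def trilinear_def by (auto simp: truncated_norm_def intro!: sum_nonneg)
  have T2: "(\<Sum>k\<in>F. (T k)\<^sup>2) \<le> 4 * 4 * S ^ 3"
    unfolding T_def S_def by (rule trilinear_l2_bound) (use F truncated_norm_sum_le recip_abs_square_sum in auto)
  \<comment> \<open>Duality: pairing the l^2 bound for the cubic remainder with \<open>a\<close>
    makes it quartic, that is, quadratic in the mass.\<close>
  have "(\<Sum>k\<in>F. cmod (a k) * T k)\<^sup>2 \<le> S * (\<Sum>k\<in>F. (T k)\<^sup>2)"
    unfolding S_def by (rule Cauchy_Schwarz_ineq_sum)
  also have "\<dots> \<le> S * (4 * 4 * S ^ 3)" by (rule mult_left_mono[OF T2 S0])
  also have "\<dots> = (4 * S\<^sup>2)\<^sup>2" by (simp add: power2_eq_square power3_eq_cube)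
  finally have aT: "(\<Sum>k\<in>F. cmod (a k) * T k) \<le> 4 * S\<^sup>2" by (rule power2_le_imp_le) simp
  have "cmod (\<Sum>k\<in>F. cnj (a k) * cubic L F a k) \<le> (\<Sum>k\<in>F. 3 * S * (cmod (a k))\<^sup>2 + L\<^sup>2 / (4 * pi\<^sup>2) * (cmod (a k) * T k))"
  proof (rule order_trans[OF norm_sum sum_mono])
    fix k assume k: "k \<in> F"
    have ak: "(cmod (a k))\<^sup>2 \<le> S" unfolding S_def by (rule member_le_sum) (use k F in auto)
    have "cmod (cubic L F a k) \<le> cmod (cubic L F a k - (2 * S - (cmod (a k))\<^sup>2) * a k) + cmod ((2 * S - (cmod (a k))\<^sup>2) * a k)"
      by (metis diff_add_cancel norm_triangle_ineq)
    also have "\<dots> \<le> L\<^sup>2 / (4 * pi\<^sup>2) * T k + 3 * S * cmod (a k)"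
    proof (rule add_mono)
      show "cmod (cubic L F a k - (2 * S - (cmod (a k))\<^sup>2) * a k) \<le> L\<^sup>2 / (4 * pi\<^sup>2) * T k"
        using cubic_resonance[OF L F k, of a] by (simp add: S_def T_def)
      have "cmod ((2 * S - (cmod (a k))\<^sup>2) * a k) = \<bar>2 * S - (cmod (a k))\<^sup>2\<bar> * cmod (a k)"
        unfolding norm_mult by (metis norm_of_real of_real_diff of_real_mult of_real_numeral of_real_power)
      also have "\<dots> \<le> 3 * S * cmod (a k)"
      proof (rule mult_right_mono)
        show "\<bar>2 * S - (cmod (a k))\<^sup>2\<bar> \<le> 3 * S"
          using ak S0 zero_le_power2[of "cmod (a k)"] unfolding abs_le_iff by linarith
      qed simp
      finally show "cmod ((2 * S - (cmod (a k))\<^sup>2) * a k) \<le> 3 * S * cmod (a k)" .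
    qed
    finally have "cmod (a k) * cmod (cubic L F a k) \<le> cmod (a k) * (L\<^sup>2 / (4 * pi\<^sup>2) * T k + 3 * S * cmod (a k))"
      by (rule mult_left_mono) simp
    then show "cmod (cnj (a k) * cubic L F a k) \<le> 3 * S * (cmod (a k))\<^sup>2 + L\<^sup>2 / (4 * pi\<^sup>2) * (cmod (a k) * T k)"
      by (simp add: norm_mult power2_eq_square algebra_simps)
  qed
  also have "\<dots> = 3 * S * S + L\<^sup>2 / (4 * pi\<^sup>2) * (\<Sum>k\<in>F. cmod (a k) * T k)"
    by (simp only: sum.distrib sum_distrib_left[symmetric] S_def[symmetric])
  also have "\<dots> \<le> 3 * S * S + L\<^sup>2 / (4 * pi\<^sup>2) * (4 * S\<^sup>2)"
    by (intro add_left_mono mult_left_mono aT) simp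
  also have "\<dots> = (3 + L\<^sup>2 / pi\<^sup>2) * S\<^sup>2" by (simp add: power2_eq_square algebra_simps)
  finally have "cmod (\<Sum>k\<in>F. cnj (a k) * cubic L F a k) / L \<le> (3 + L\<^sup>2 / pi\<^sup>2) * S\<^sup>2 / L"
    using L by (intro divide_right_mono) auto
  then show ?thesis using L by (simp add: norm_mult norm_divide strichartz_const_def S_def)
qed

text \<open>On the diagonal \<open>b = a\<close> the quartic form is the fourth power of the
  space-time L^4 norm.\<close>

lemma evolve_L4:
  assumes L: "L > 0" and F: "finite F"
  shows "integral\<^sup>L (time \<Otimes>\<^sub>M torus L) (\<lambda>w. cmod (evolve L F a (fst w) (snd w)) ^ 4)
     \<le> strichartz_const L * (\<Sum>k\<in>F. (cmod (a k))\<^sup>2)\<^sup>2"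
proof -
  have z4: "complex_of_real (cmod z ^ 4) = cnj z * z * cnj z * z" for z
  proof -
    have "complex_of_real (cmod z ^ 4) = complex_of_real ((cmod z)\<^sup>2) * complex_of_real ((cmod z)\<^sup>2)"
      by (simp flip: of_real_mult power_add)
    then show ?thesis unfolding complex_norm_square by (simp add: mult_ac)
  qed
  have "complex_of_real (integral\<^sup>L (time \<Otimes>\<^sub>M torus L) (\<lambda>w. cmod (evolve L F a (fst w) (snd w)) ^ 4)) =
     of_real (1 / L) * (\<Sum>k\<in>F. cnj (a k) * cubic L F a k)"
    unfolding integral_complex_of_real[symmetric] z4 by (rule evolve_quartic[OF L F])
  then have "cmod (complex_of_real (integral\<^sup>L (time \<Otimes>\<^sub>M torus L) (\<lambda>w. cmod (evolve L F a (fst w) (snd w)) ^ 4)))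
     \<le> strichartz_const L * (\<Sum>k\<in>F. (cmod (a k))\<^sup>2)\<^sup>2"
    using strichartz_bound[OF L F, of a] by simp
  then show ?thesis unfolding norm_of_real by linarith
qed

section \<open>Evolution of square integrable data\<close>

text \<open>Peeling off the first term by (x + T)^2 \<le> 2 x^2 + 2 T^2 doubles the weight of
  everything behind it. These weights are affordable because the block masses below decay like
  1/4^i.\<close>

lemma sum_square_dyadic:
  fixes x :: "nat \<Rightarrow> real"
  shows "(\<Sum>i<n. x i)\<^sup>2 \<le> 2 * (\<Sum>i<n. 2 ^ i * (x i)\<^sup>2)"
proof (induction n arbitrary: x)
  case (Suc n)
  let ?T = "\<Sum>i<n. x (Suc i)"
  have "(\<Sum>i<Suc n. x i)\<^sup>2 = (x 0 + ?T)\<^sup>2" by (simp add: sum.lessThan_Suc_shift del: sum.lessThan_Suc)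
  also have "\<dots> \<le> 2 * (x 0)\<^sup>2 + 2 * ?T\<^sup>2"
    using zero_le_power2[of "x 0 - ?T"] by (simp add: power2_eq_square algebra_simps)
  also have "?T\<^sup>2 \<le> 2 * (\<Sum>i<n. 2 ^ i * (x (Suc i))\<^sup>2)" by (rule Suc)
  also have "2 * (x 0)\<^sup>2 + 2 * (2 * (\<Sum>i<n. 2 ^ i * (x (Suc i))\<^sup>2)) = 2 * (\<Sum>i<Suc n. 2 ^ i * (x i)\<^sup>2)"
    by (simp add: sum.lessThan_Suc_shift sum_distrib_left algebra_simps del: sum.lessThan_Suc)
  finally show ?case by simp
qed simp

text \<open>Either \<open>t\<close> is below the geometric threshold, or \<open>2 ^ i * t\<close>
  exceeds 1 and may be inserted as a factor. Summable weighted squares therefore force absolute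
  summability.\<close>

lemma le_dyadic_square: "(t::real) \<ge> 0 \<Longrightarrow> t \<le> (1 / 2) ^ i + 2 ^ i * t\<^sup>2"
proof (cases "t \<le> (1 / 2) ^ i")
  case True
  then show ?thesis by (simp add: add_increasing2)
next
  case False
  assume t: "t \<ge> 0"
  have "1 \<le> 2 ^ i * t" using False by (simp add: power_one_over field_simps)
  then have "t \<le> (2 ^ i * t) * t" using t mult_right_mono[of 1 "2 ^ i * t" t] by simp
  then show ?thesis by (simp add: power2_eq_square mult_ac add_increasing)
qed

lemma le_dyadic_fourth: "(t::real) \<ge> 0 \<Longrightarrow> t \<le> (1 / 2) ^ i + 8 ^ i * t ^ 4"
proof (cases "t \<le> (1 / 2) ^ i")
  case True
  then show ?thesis by (simp add: add_increasing2)
next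
  case False
  assume t: "t \<ge> 0"
  have "1 \<le> 2 ^ i * t" using False by (simp add: power_one_over field_simps)
  then have "1 \<le> (2 ^ i * t) ^ 3" by (rule one_le_power)
  then have "t \<le> (2 ^ i * t) ^ 3 * t" using t mult_right_mono[of 1 "(2 ^ i * t) ^ 3" t] by simp
  also have "\<dots> = ((2 ^ i) ^ 3) * t ^ 4" by (simp add: power_mult_distrib power3_eq_cube power4_eq_xxxx)
  also have "((2::real) ^ i) ^ 3 = (2 ^ 3) ^ i" by (metis power_mult mult.commute)
  finally show ?thesis by (simp add: add_increasing)
qed

text \<open>Monotone convergence in \<open>ennreal\<close>: the sum has finite integral and is
  therefore finite almost everywhere.\<close>

lemma AE_summable_of_summable_integrals:
  fixes f :: "nat \<Rightarrow> 'a \<Rightarrow> real"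
  assumes f: "\<And>i. integrable M (f i)" "\<And>i x. f i x \<ge> 0" and s: "summable (\<lambda>i. integral\<^sup>L M (f i))"
  shows "AE x in M. summable (\<lambda>i. f i x)" and "integrable M (\<lambda>x. \<Sum>i. f i x)"
proof -
  have [measurable]: "f i \<in> borel_measurable M" for i using f(1)[of i] by simp
  have nn: "integral\<^sup>N M (\<lambda>x. ennreal (f i x)) = ennreal (integral\<^sup>L M (f i))" for i
    by (rule nn_integral_eq_integral) (use f in auto)
  have "integral\<^sup>N M (\<lambda>x. \<Sum>i. ennreal (f i x)) = (\<Sum>i. ennreal (integral\<^sup>L M (f i)))"
    by (subst nn_integral_suminf) (simp_all add: nn)
  also have "\<dots> = ennreal (\<Sum>i. integral\<^sup>L M (f i))"
    by (rule suminf_ennreal2) (use f s in auto)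
  finally have "integral\<^sup>N M (\<lambda>x. \<Sum>i. ennreal (f i x)) \<noteq> \<infinity>" by simp
  then have "AE x in M. (\<Sum>i. ennreal (f i x)) \<noteq> \<infinity>"
    by (intro nn_integral_noteq_infinite) auto
  then show ae: "AE x in M. summable (\<lambda>i. f i x)"
    by eventually_elim (use f(2) in \<open>auto intro!: summable_suminf_not_top\<close>)
  show "integrable M (\<lambda>x. \<Sum>i. f i x)"
    by (rule integrable_suminf) (use f s ae in auto)
qed

section \<open>Sparse frequency blocks and almost everywhere convergence\<close>

definition mode_range :: "(nat \<Rightarrow> nat) \<Rightarrow> nat \<Rightarrow> int set" where
  "mode_range N j = {- int (N j)..int (N j)}"

definition mode_block :: "(nat \<Rightarrow> nat) \<Rightarrow> nat \<Rightarrow> int set" where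
  "mode_block N i = (case i of 0 \<Rightarrow> mode_range N 0 | Suc j \<Rightarrow> mode_range N (Suc j) - mode_range N j)"

lemma finite_mode_range [simp]: "finite (mode_range N j)" by (simp add: mode_range_def)

lemma finite_mode_block [simp]: "finite (mode_block N i)" by (auto simp: mode_block_def split: nat.split)

lemma eventually_in_mode_range:
  assumes "strict_mono N"
  shows "\<forall>\<^sub>F j in sequentially. k \<in> mode_range N j"
  using eventually_ge_at_top[of "nat \<bar>k\<bar>"]
proof eventually_elim
  case (elim j)
  moreover have "j \<le> N j" by (rule strict_mono_imp_increasing[OF assms])
  ultimately show ?case by (auto simp: mode_range_def)
qed

text \<open>
  The geometric decay of the block norms makes the partial sums up to \<open>N j\<close> converge almost everywhere at
  every time, dominated in L^2 at each time and in L^4 on space-time, so that no completeness of an L^p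
  space is needed.
\<close>

locale rapid_blocks =
  fixes L :: real and a :: "int \<Rightarrow> complex" and N :: "nat \<Rightarrow> nat" and K :: real
  assumes L: "L > 0" and N: "strict_mono N"
    and block_bound: "\<And>i. (\<Sum>k\<in>mode_block N i. (cmod (a k))\<^sup>2) \<le> K / 4 ^ i"
begin

definition partial :: "nat \<Rightarrow> real \<Rightarrow> real \<Rightarrow> complex" where
  "partial j r x = evolve L (mode_range N j) a r x"

definition block :: "nat \<Rightarrow> real \<Rightarrow> real \<Rightarrow> complex" where
  "block i r x = evolve L (mode_block N i) a r x"

text \<open>An explicit pointwise limit in place of a choice for each \<open>r\<close>: this makes
  the evolution jointly measurable in \<open>(r, x)\<close>.\<close>

definition solution :: "real \<Rightarrow> real \<Rightarrow> complex" where
  "solution r x = lim (\<lambda>j. partial j r x)"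

lemma partial_eq_sum_blocks: "partial j r x = (\<Sum>i<Suc j. block i r x)"
proof (induction j)
  case 0
  then show ?case by (simp add: partial_def block_def mode_block_def)
next
  case (Suc j)
  have sub: "mode_range N j \<subseteq> mode_range N (Suc j)"
    using strict_mono_less_eq[OF N, of j "Suc j"] by (auto simp: mode_range_def)
  have "partial (Suc j) r x = evolve L (mode_range N (Suc j) - mode_range N j) a r x + partial j r x"
    unfolding partial_def evolve_def by (rule sum.subset_diff[OF sub]) simp
  then show ?case using Suc by (simp add: block_def mode_block_def)
qed

lemma partial_measurable [measurable (raw)]:
  "f \<in> borel_measurable M \<Longrightarrow> g \<in> borel_measurable M \<Longrightarrow> (\<lambda>w. partial j (f w) (g w)) \<in> borel_measurable M"
  unfolding partial_def by (rule evolve_measurable)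

lemma block_measurable [measurable (raw)]:
  "f \<in> borel_measurable M \<Longrightarrow> g \<in> borel_measurable M \<Longrightarrow> (\<lambda>w. block j (f w) (g w)) \<in> borel_measurable M"
  unfolding block_def by (rule evolve_measurable)

lemma solution_measurable [measurable (raw)]:
  "f \<in> borel_measurable M \<Longrightarrow> g \<in> borel_measurable M \<Longrightarrow> (\<lambda>w. solution (f w) (g w)) \<in> borel_measurable M"
  unfolding solution_def by (intro borel_measurable_lim_metric partial_measurable)

lemma solution_periodic: "periodic L (solution r)"
  by (simp add: periodic_def solution_def partial_def evolve_def mode_periodic[OF L])

lemma norm_block_le: "cmod (block i r x) \<le> (\<Sum>k\<in>mode_block N i. cmod (a k)) / sqrt L"
  unfolding block_def by (rule norm_evolve_le[OF L])

definition square_bound :: "real \<Rightarrow> real \<Rightarrow> real" where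
  "square_bound r x = 2 * (\<Sum>i. 2 ^ i * (cmod (block i r x))\<^sup>2)"

definition fourth_bound :: "real \<Rightarrow> real \<Rightarrow> real" where
  "fourth_bound r x = 8 * (\<Sum>i. 8 ^ i * cmod (block i r x) ^ 4)"

lemma norm_partial_square_le:
  "(cmod (partial j r x))\<^sup>2 \<le> 2 * (\<Sum>i<Suc j. 2 ^ i * (cmod (block i r x))\<^sup>2)"
proof -
  have "(cmod (partial j r x))\<^sup>2 \<le> (\<Sum>i<Suc j. cmod (block i r x))\<^sup>2"
    unfolding partial_eq_sum_blocks by (intro power_mono norm_sum) simp
  also have "\<dots> \<le> 2 * (\<Sum>i<Suc j. 2 ^ i * (cmod (block i r x))\<^sup>2)" by (rule sum_square_dyadic)
  finally show ?thesis .
qed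

text \<open>\<open>sum_square_dyadic\<close> applied twice: the weights combine to
  \<open>2^i * (2^i)^2 = 8^i\<close>, the constants to \<open>4 * 2 = 8\<close>.\<close>

lemma norm_partial_fourth_le:
  "cmod (partial j r x) ^ 4 \<le> 8 * (\<Sum>i<Suc j. 8 ^ i * cmod (block i r x) ^ 4)"
proof -
  have "cmod (partial j r x) ^ 4 = ((cmod (partial j r x))\<^sup>2)\<^sup>2" by (simp flip: power_mult)
  also have "\<dots> \<le> (2 * (\<Sum>i<Suc j. 2 ^ i * (cmod (block i r x))\<^sup>2))\<^sup>2"
    by (rule power_mono[OF norm_partial_square_le]) simp
  also have "\<dots> = 4 * (\<Sum>i<Suc j. 2 ^ i * (cmod (block i r x))\<^sup>2)\<^sup>2"
  proof -
    have "(2 * s)\<^sup>2 = 4 * s\<^sup>2" for s :: real by simp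
    then show ?thesis .
  qed
  also have "\<dots> \<le> 4 * (2 * (\<Sum>i<Suc j. 2 ^ i * (2 ^ i * (cmod (block i r x))\<^sup>2)\<^sup>2))"
    by (intro mult_left_mono sum_square_dyadic) simp
  also have "(\<Sum>i<Suc j. 2 ^ i * (2 ^ i * (cmod (block i r x))\<^sup>2)\<^sup>2) = (\<Sum>i<Suc j. 8 ^ i * cmod (block i r x) ^ 4)"
  proof (rule sum.cong[OF refl])
    fix i
    have "(2::real) ^ i * (2 ^ i * (2 ^ i)) = 8 ^ i" by (simp flip: power_mult_distrib)
    then show "2 ^ i * (2 ^ i * (cmod (block i r x))\<^sup>2)\<^sup>2 = 8 ^ i * cmod (block i r x) ^ 4"
      by (simp add: power2_eq_square power4_eq_xxxx mult_ac)
  qed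
  finally show ?thesis by simp
qed

lemma partial_convergent:
  assumes "summable (\<lambda>i. cmod (block i r x))"
  shows "(\<lambda>j. partial j r x) \<longlonglongrightarrow> solution r x"
proof -
  have "summable (\<lambda>i. block i r x)" by (rule summable_norm_cancel[OF assms])
  then have "(\<lambda>n. \<Sum>i<n. block i r x) \<longlonglongrightarrow> (\<Sum>i. block i r x)" by (rule summable_LIMSEQ)
  then have "(\<lambda>j. partial j r x) \<longlonglongrightarrow> (\<Sum>i. block i r x)"
    unfolding partial_eq_sum_blocks by (rule LIMSEQ_Suc)
  then show ?thesis unfolding solution_def by (simp add: limI)
qed

lemma half_summable: "summable (\<lambda>i. (1 / 2 :: real) ^ i)" by (rule summable_geometric) simp

lemma summable_block_of_square:
  assumes "summable (\<lambda>i. 2 ^ i * (cmod (block i r x))\<^sup>2)"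
  shows "summable (\<lambda>i. cmod (block i r x))"
  by (rule summable_comparison_test'[OF summable_add[OF half_summable assms], of 0])
     (simp add: le_dyadic_square)

lemma summable_block_of_fourth:
  assumes "summable (\<lambda>i. 8 ^ i * cmod (block i r x) ^ 4)"
  shows "summable (\<lambda>i. cmod (block i r x))"
  by (rule summable_comparison_test'[OF summable_add[OF half_summable assms], of 0])
     (simp add: le_dyadic_fourth)

lemma partial_square_dominated:
  assumes "summable (\<lambda>i. 2 ^ i * (cmod (block i r x))\<^sup>2)"
  shows "(cmod (partial j r x))\<^sup>2 \<le> square_bound r x"
proof -
  have "(\<Sum>i<Suc j. 2 ^ i * (cmod (block i r x))\<^sup>2) \<le> (\<Sum>i. 2 ^ i * (cmod (block i r x))\<^sup>2)"
    by (rule sum_le_suminf[OF assms]) auto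
  then show ?thesis using norm_partial_square_le[of j r x] by (simp add: square_bound_def)
qed

lemma partial_fourth_dominated:
  assumes "summable (\<lambda>i. 8 ^ i * cmod (block i r x) ^ 4)"
  shows "cmod (partial j r x) ^ 4 \<le> fourth_bound r x"
proof -
  have "(\<Sum>i<Suc j. 8 ^ i * cmod (block i r x) ^ 4) \<le> (\<Sum>i. 8 ^ i * cmod (block i r x) ^ 4)"
    by (rule sum_le_suminf[OF assms]) auto
  then show ?thesis using norm_partial_fourth_le[of j r x] by (simp add: fourth_bound_def)
qed

text \<open>By conservation of mass block \<open>i\<close> has mass at most \<open>K / 4^i\<close>
  at every time, so the weight \<open>2^i\<close> still leaves a geometric series.\<close>

lemma square_bound:
  shows "AE x in torus L. summable (\<lambda>i. 2 ^ i * (cmod (block i r x))\<^sup>2)"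
    and "integrable (torus L) (square_bound r)"
proof -
  let ?f = "\<lambda>i x. 2 ^ i * (cmod (block i r x))\<^sup>2"
  have i: "integrable (torus L) (\<lambda>x. (cmod (block i r x))\<^sup>2)" for i
  proof (rule finite_measure.integrable_const_bound[OF finite_measure_interval])
    show "AE x in torus L. norm ((cmod (block i r x))\<^sup>2) \<le> ((\<Sum>k\<in>mode_block N i. cmod (a k)) / sqrt L)\<^sup>2"
      using norm_block_le by (intro AE_I2) (auto intro!: power_mono)
  qed measurable
  have i2: "integrable (torus L) (?f i)" for i using i by simp
  have val: "integral\<^sup>L (torus L) (?f i) = 2 ^ i * (\<Sum>k\<in>mode_block N i. (cmod (a k))\<^sup>2)" for i
    using evolve_L2[OF L finite_mode_block, of N i a r] by (simp add: block_def)
  have "summable (\<lambda>i. K * (1 / 2) ^ i)" by (intro summable_mult half_summable)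
  then have s: "summable (\<lambda>i. integral\<^sup>L (torus L) (?f i))"
  proof (rule summable_comparison_test'[of _ 0])
    fix i
    have "2 ^ i * (\<Sum>k\<in>mode_block N i. (cmod (a k))\<^sup>2) \<le> 2 ^ i * (K / 4 ^ i)"
      by (intro mult_left_mono block_bound) simp
    also have "\<dots> = K * (1 / 2) ^ i"
    proof -
      have "(4::real) ^ i = 2 ^ i * 2 ^ i" by (simp flip: power_mult_distrib)
      then show ?thesis by (simp add: power_one_over)
    qed
    finally show "norm (integral\<^sup>L (torus L) (?f i)) \<le> K * (1 / 2) ^ i"
      unfolding val by (simp add: sum_nonneg)
  qed
  show "AE x in torus L. summable (\<lambda>i. ?f i x)"
    by (rule AE_summable_of_summable_integrals(1)[OF i2 _ s]) simp
  show "integrable (torus L) (square_bound r)"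
    unfolding square_bound_def
    by (intro integrable_mult_right AE_summable_of_summable_integrals(2)[OF i2 _ s]) simp
qed

text \<open>The Strichartz bound is quadratic in the mass of a block, so block \<open>i\<close>
  contributes at most a constant times \<open>8^i * (K / 4^i)^2 = K^2 / 2^i\<close>.\<close>

lemma fourth_bound:
  shows "AE w in time \<Otimes>\<^sub>M torus L. summable (\<lambda>i. 8 ^ i * cmod (block i (fst w) (snd w)) ^ 4)"
    and "integrable (time \<Otimes>\<^sub>M torus L) (\<lambda>w. fourth_bound (fst w) (snd w))"
proof -
  let ?f = "\<lambda>i w. 8 ^ i * cmod (block i (fst w) (snd w)) ^ 4"
  have i: "integrable (time \<Otimes>\<^sub>M torus L) (\<lambda>w. cmod (block i (fst w) (snd w)) ^ 4)" for i
    by (rule integrable_spacetime_bounded[of _ _ "((\<Sum>k\<in>mode_block N i. cmod (a k)) / sqrt L) ^ 4"])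
       (auto intro!: power_mono norm_block_le)
  have i2: "integrable (time \<Otimes>\<^sub>M torus L) (?f i)" for i using i by simp
  have val: "integral\<^sup>L (time \<Otimes>\<^sub>M torus L) (?f i) \<le> 8 ^ i * (strichartz_const L * (\<Sum>k\<in>mode_block N i. (cmod (a k))\<^sup>2)\<^sup>2)" for i
    using evolve_L4[OF L finite_mode_block, of N i a] by (simp add: block_def)
  have C0: "strichartz_const L \<ge> 0" using L by (simp add: strichartz_const_def)
  have "summable (\<lambda>i. strichartz_const L * K\<^sup>2 * (1 / 2) ^ i)" by (intro summable_mult half_summable)
  then have s: "summable (\<lambda>i. integral\<^sup>L (time \<Otimes>\<^sub>M torus L) (?f i))"
  proof (rule summable_comparison_test'[of _ 0])
    fix i
    have "(\<Sum>k\<in>mode_block N i. (cmod (a k))\<^sup>2)\<^sup>2 \<le> (K / 4 ^ i)\<^sup>2"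
      by (intro power_mono block_bound) (simp add: sum_nonneg)
    then have "8 ^ i * (strichartz_const L * (\<Sum>k\<in>mode_block N i. (cmod (a k))\<^sup>2)\<^sup>2) \<le> 8 ^ i * (strichartz_const L * (K / 4 ^ i)\<^sup>2)"
      by (intro mult_left_mono C0) auto
    also have "\<dots> = strichartz_const L * K\<^sup>2 * (1 / 2) ^ i"
    proof -
      have "(8::real) ^ i * 2 ^ i = (4 ^ i)\<^sup>2" by (simp add: power2_eq_square flip: power_mult_distrib)
      then have "(8::real) ^ i / (4 ^ i)\<^sup>2 = (1 / 2) ^ i" by (simp add: power_one_over nonzero_divide_eq_eq eq_divide_eq)
      moreover have "8 ^ i * (strichartz_const L * (K / 4 ^ i)\<^sup>2) = strichartz_const L * K\<^sup>2 * (8 ^ i / (4 ^ i)\<^sup>2)"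
        by (simp add: power_divide)
      ultimately show ?thesis by simp
    qed
    finally have b: "8 ^ i * (strichartz_const L * (\<Sum>k\<in>mode_block N i. (cmod (a k))\<^sup>2)\<^sup>2) \<le>
        strichartz_const L * K\<^sup>2 * (1 / 2) ^ i" .
    have "norm (integral\<^sup>L (time \<Otimes>\<^sub>M torus L) (?f i)) = integral\<^sup>L (time \<Otimes>\<^sub>M torus L) (?f i)"
      unfolding real_norm_def by (intro abs_of_nonneg integral_nonneg) simp
    then show "norm (integral\<^sup>L (time \<Otimes>\<^sub>M torus L) (?f i)) \<le> strichartz_const L * K\<^sup>2 * (1 / 2) ^ i"
      using order_trans[OF val[of i] b] by (simp only:)
  qed
  show "AE w in time \<Otimes>\<^sub>M torus L. summable (\<lambda>i. ?f i w)"
    by (rule AE_summable_of_summable_integrals(1)[OF i2 _ s]) simp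
  show "integrable (time \<Otimes>\<^sub>M torus L) (\<lambda>w. fourth_bound (fst w) (snd w))"
    unfolding fourth_bound_def
    by (intro integrable_mult_right AE_summable_of_summable_integrals(2)[OF i2 _ s]) simp
qed

lemma AE_partial_tendsto: "AE x in torus L. (\<lambda>j. partial j r x) \<longlonglongrightarrow> solution r x"
  using square_bound(1)[of r]
  by eventually_elim (intro partial_convergent summable_block_of_square)

lemma AE_solution_square_le: "AE x in torus L. (cmod (solution r x))\<^sup>2 \<le> square_bound r x"
  using square_bound(1)[of r] AE_partial_tendsto[of r]
proof eventually_elim
  case (elim x)
  have "(\<lambda>j. (cmod (partial j r x))\<^sup>2) \<longlonglongrightarrow> (cmod (solution r x))\<^sup>2"
    by (intro tendsto_intros elim)
  then show ?case by (rule LIMSEQ_le_const2) (use partial_square_dominated[OF elim(1)] in auto)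
qed

lemma solution_in_torus_L2: "solution r \<in> torus_L2 L"
proof -
  have m: "solution r \<in> borel_measurable lebesgue"
    by (rule solution_measurable) (auto simp: borel_measurable_ident_lebesgue_on[of UNIV, unfolded lebesgue_on_UNIV_eq])
  have "integrable (torus L) (\<lambda>x. (cmod (solution r x))\<^sup>2)"
  proof (rule Bochner_Integration.integrable_bound[OF square_bound(2)])
    show "(\<lambda>x. (cmod (solution r x))\<^sup>2) \<in> borel_measurable (torus L)" by measurable
    show "AE x in torus L. norm ((cmod (solution r x))\<^sup>2) \<le> norm (square_bound r x)"
      using AE_solution_square_le[of r] by eventually_elim simp
  qed
  then show ?thesis using m solution_periodic by (simp add: torus_L2_def set_integrable_lebesgue_on)
qed

lemma solution_fourier:
  "torus_fourier L (solution r) k = cis (- (4 * pi\<^sup>2 * (of_int k)\<^sup>2 * r / L\<^sup>2)) * a k"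
proof -
  have "(\<lambda>j. integral\<^sup>L (torus L) (\<lambda>x. partial j r x * cnj (mode L k 0 x))) \<longlonglongrightarrow>
      integral\<^sup>L (torus L) (\<lambda>x. solution r x * cnj (mode L k 0 x))"
  \<comment> \<open>The inequality t \<le> 1 + t^2 passes from the square bound to a first power;
    \<open>1 / sqrt L\<close> is the modulus of the mode.\<close>
  proof (rule integral_dominated_convergence[where w = "\<lambda>x. (1 + square_bound r x) * (1 / sqrt L)"])
    interpret finite_measure "torus L" by (rule finite_measure_interval)
    show "integrable (torus L) (\<lambda>x. (1 + square_bound r x) * (1 / sqrt L))"
      using square_bound(2) by (intro integrable_mult_left Bochner_Integration.integrable_add) auto
    show "AE x in torus L. (\<lambda>j. partial j r x * cnj (mode L k 0 x)) \<longlonglongrightarrow> solution r x * cnj (mode L k 0 x)"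
      using AE_partial_tendsto[of r] by eventually_elim (intro tendsto_intros)
    show "AE x in torus L. cmod (partial j r x * cnj (mode L k 0 x)) \<le> (1 + square_bound r x) * (1 / sqrt L)" for j
      using square_bound(1)[of r]
    proof eventually_elim
      case (elim x)
      have "cmod (partial j r x) \<le> 1 + (cmod (partial j r x))\<^sup>2"
        using le_dyadic_square[of "cmod (partial j r x)" 0] by simp
      also have "\<dots> \<le> 1 + square_bound r x" using partial_square_dominated[OF elim] by simp
      finally show ?case unfolding norm_mult complex_mod_cnj norm_mode[OF L]
        by (rule mult_right_mono) (use L in simp)
    qed
  qed measurable
  moreover have "(\<lambda>j. integral\<^sup>L (torus L) (\<lambda>x. partial j r x * cnj (mode L k 0 x))) \<longlonglongrightarrow>
      cis (- (4 * pi\<^sup>2 * (of_int k)\<^sup>2 * r / L\<^sup>2)) * a k"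
  \<comment> \<open>Once the range contains \<open>k\<close>, the coefficient of the partial sum no
    longer changes.\<close>
  proof (rule tendsto_eventually)
    show "\<forall>\<^sub>F j in sequentially. integral\<^sup>L (torus L) (\<lambda>x. partial j r x * cnj (mode L k 0 x)) =
      cis (- (4 * pi\<^sup>2 * (of_int k)\<^sup>2 * r / L\<^sup>2)) * a k"
      using eventually_in_mode_range[OF N, of k]
      by eventually_elim (simp add: partial_def evolve_fourier[OF L])
  qed
  ultimately show ?thesis unfolding torus_fourier_mode by (rule LIMSEQ_unique)
qed

text \<open>\<open>solution\<close> witnesses the existential behind the choice operator, so the
  chosen function has the prescribed coefficients, and uniqueness identifies the two at each fixed
  time.\<close>

lemma AE_schroedinger_eq_solution:
  assumes a: "\<And>k. a k = torus_fourier L f k"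
  shows "schroedinger L r f \<in> torus_L2 L" and "AE x in lebesgue. schroedinger L r f x = solution r x"
proof -
  let ?P = "\<lambda>u. u \<in> torus_L2 L \<and> (\<forall>k. torus_fourier L u k =
     exp (- (complex_of_real (4 * pi\<^sup>2) * \<i> * (complex_of_int k)\<^sup>2 * complex_of_real r / (complex_of_real L)\<^sup>2)) * torus_fourier L f k)"
  have sol: "?P (solution r)"
    using solution_in_torus_L2 solution_fourier a unfolding exp_phase by simp
  then have s: "?P (schroedinger L r f)" unfolding schroedinger_def by (rule someI[of ?P])
  then show "schroedinger L r f \<in> torus_L2 L" by simp
  show "AE x in lebesgue. schroedinger L r f x = solution r x"
    by (rule torus_fourier_unique[OF L]) (use s sol in auto)
qed

lemma AE_spacetime_partial_tendsto:
  "AE w in time \<Otimes>\<^sub>M torus L. (\<lambda>j. partial j (fst w) (snd w)) \<longlonglongrightarrow> solution (fst w) (snd w)"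
  using fourth_bound(1) by eventually_elim (intro partial_convergent summable_block_of_fourth)

end

section \<open>Passage to the limit in the quartic form\<close>

lemma rapid_blocks_exist:
  fixes w :: "int \<Rightarrow> real"
  assumes w: "\<And>k. w k \<ge> 0" "\<And>S. finite S \<Longrightarrow> (\<Sum>k\<in>S. w k) \<le> M"
  obtains N K where "strict_mono N" "\<And>i. (\<Sum>k\<in>mode_block N i. w k) \<le> K / 4 ^ i"
proof -
  have "\<exists>n::nat. \<forall>S. finite S \<longrightarrow> (\<forall>k\<in>S. int n < \<bar>k\<bar>) \<longrightarrow> (\<Sum>k\<in>S. w k) \<le> 1 / 4 ^ Suc i" for i
  proof -
    have sq: "(\<Sum>k\<in>S. (sqrt (w k))\<^sup>2) = (\<Sum>k\<in>S. w k)" for S using w(1) by simp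
    have "(\<Sum>k\<in>S. (sqrt (w k))\<^sup>2) \<le> M" if "finite S" for S unfolding sq using w(2)[OF that] .
    from l2_small_tail[OF this, of "1 / 4 ^ Suc i"] show ?thesis unfolding sq by (metis zero_less_divide_1_iff zero_less_numeral zero_less_power)
  qed
  then obtain n :: "nat \<Rightarrow> nat" where n: "\<And>i S. finite S \<Longrightarrow> (\<And>k. k \<in> S \<Longrightarrow> int (n i) < \<bar>k\<bar>) \<Longrightarrow> (\<Sum>k\<in>S. w k) \<le> 1 / 4 ^ Suc i"
    by metis
  \<comment> \<open>The cumulative sum makes \<open>N j \<ge> n j\<close>, so block
    \<open>Suc j\<close>, which lies outside range \<open>j\<close>, has mass at most
    \<open>1 / 4 ^ Suc j\<close>; the summand \<open>i\<close> makes \<open>N\<close> strictly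
    increasing.\<close>
  define N where "N = (\<lambda>i. (\<Sum>j\<le>i. n j) + i)"
  have "strict_mono N" by (intro strict_monoI_Suc) (simp add: N_def)
  moreover have "(\<Sum>k\<in>mode_block N i. w k) \<le> max M 1 / 4 ^ i" for i
  proof (cases i)
    case 0
    have "(\<Sum>k\<in>mode_block N 0. w k) \<le> M" by (rule w(2)) simp
    then show ?thesis using 0 by simp
  next
    case (Suc j)
    have nj: "n j \<le> N j" unfolding N_def using member_le_sum[of j "{..j}" n] by simp
    have "(\<Sum>k\<in>mode_block N i. w k) \<le> 1 / 4 ^ Suc j"
      by (rule n) (use Suc nj in \<open>auto simp: mode_block_def mode_range_def\<close>)
    also have "\<dots> \<le> max M 1 / 4 ^ i" unfolding Suc by (rule divide_right_mono) auto
    finally show ?thesis .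
  qed
  ultimately show ?thesis by (rule that)
qed

text \<open>Dominated convergence on space-time followed by Fubini. From here on the form is handled
  as a limit of explicit finite sums.\<close>

lemma Q4_limit:
  assumes L: "L > 0" and f: "f \<in> torus_L2 L" and g: "g \<in> torus_L2 L"
  obtains N where "strict_mono N"
    "(\<lambda>j. of_real (1 / L) * (\<Sum>k\<in>mode_range N j. cnj (torus_fourier L g k) * cubic L (mode_range N j) (torus_fourier L f) k))
       \<longlonglongrightarrow> Q4 L g f f f"
proof -
  let ?P = "time \<Otimes>\<^sub>M torus L"
  \<comment> \<open>Adding the two masses produces one sparse sequence that serves \<open>f\<close>
    and \<open>g\<close> simultaneously.\<close>
  define w where "w = (\<lambda>k. (cmod (torus_fourier L f k))\<^sup>2 + (cmod (torus_fourier L g k))\<^sup>2)"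
  have w0: "w k \<ge> 0" for k by (simp add: w_def)
  have wM: "(\<Sum>k\<in>S. w k) \<le> integral\<^sup>L (torus L) (\<lambda>x. (cmod (f x))\<^sup>2) + integral\<^sup>L (torus L) (\<lambda>x. (cmod (g x))\<^sup>2)"
    if "finite S" for S
    unfolding w_def sum.distrib by (intro add_mono bessel L f g that)
  obtain N K where N: "strict_mono N" and K: "\<And>i. (\<Sum>k\<in>mode_block N i. w k) \<le> K / 4 ^ i"
    using rapid_blocks_exist[of w, OF w0 wM] by blast
  have le: "(\<Sum>k\<in>mode_block N i. (cmod (torus_fourier L h k))\<^sup>2) \<le> K / 4 ^ i" if "h = f \<or> h = g" for h i
    by (rule order_trans[OF sum_mono K]) (use that in \<open>auto simp: w_def\<close>)
  interpret f: rapid_blocks L "torus_fourier L f" N K by unfold_locales (use L N le in auto)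
  interpret g: rapid_blocks L "torus_fourier L g" N K by unfold_locales (use L N le in auto)
  interpret ps: pair_sigma_finite time "torus L" by (rule pair_sigma_finite_spacetime)
  define A where "A = (\<lambda>j w. cnj (g.partial j (fst w) (snd w)) * f.partial j (fst w) (snd w) *
     cnj (f.partial j (fst w) (snd w)) * f.partial j (fst w) (snd w))"
  define U where "U = (\<lambda>w. cnj (g.solution (fst w) (snd w)) * f.solution (fst w) (snd w) *
     cnj (f.solution (fst w) (snd w)) * f.solution (fst w) (snd w))"
  define H where "H = (\<lambda>w. g.fourth_bound (fst w) (snd w) + f.fourth_bound (fst w) (snd w))"
  have Um: "U \<in> borel_measurable ?P" unfolding U_def by measurable
  have Am: "A j \<in> borel_measurable ?P" for j unfolding A_def by measurable
  have Hi: "integrable ?P H" unfolding H_def by (intro Bochner_Integration.integrable_add f.fourth_bound(2) g.fourth_bound(2))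
  have lim: "AE w in ?P. (\<lambda>j. A j w) \<longlonglongrightarrow> U w"
    using f.AE_spacetime_partial_tendsto g.AE_spacetime_partial_tendsto unfolding A_def U_def
    by eventually_elim (intro tendsto_intros)
  have dom: "AE w in ?P. cmod (A j w) \<le> H w" for j
    using f.fourth_bound(1) g.fourth_bound(1)
  proof eventually_elim
    case (elim w)
    let ?p = "cmod (g.partial j (fst w) (snd w))" and ?q = "cmod (f.partial j (fst w) (snd w))"
    \<comment> \<open>Replacing every factor by the larger of \<open>p\<close> and \<open>q\<close>
      splits the dominating function into the two fourth-power bounds.\<close>
    have "p * q ^ 3 \<le> p ^ 4 + q ^ 4" if "p \<ge> 0" "q \<ge> 0" for p q :: real
    proof (cases "p \<le> q")
      case True
      then have "p * q ^ 3 \<le> q * q ^ 3" using that by (intro mult_right_mono) auto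
      also have "\<dots> = q ^ 4" by (simp flip: power_Suc)
      finally show ?thesis using that by (simp add: add_increasing)
    next
      case False
      then have "p * q ^ 3 \<le> p * p ^ 3" using that by (intro mult_left_mono power_mono) auto
      also have "\<dots> = p ^ 4" by (simp flip: power_Suc)
      finally show ?thesis using that by (simp add: add_increasing2)
    qed
    from this[of ?p ?q] have "cmod (A j w) \<le> ?p ^ 4 + ?q ^ 4" by (simp add: A_def norm_mult power3_eq_cube mult_ac)
    also have "\<dots> \<le> H w" unfolding H_def
      by (intro add_mono f.partial_fourth_dominated g.partial_fourth_dominated elim)
    finally show ?case .
  qed
  note dct = integral_dominated_convergence[OF Um Am Hi lim dom]
    integrable_dominated_convergence[OF Um Am Hi lim dom]
  have "integral\<^sup>L ?P (A j) = of_real (1 / L) * (\<Sum>k\<in>mode_range N j. cnj (torus_fourier L g k) * cubic L (mode_range N j) (torus_fourier L f) k)" for j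
    unfolding A_def f.partial_def g.partial_def by (rule evolve_quartic[OF L]) simp
  moreover have "integral\<^sup>L ?P U = Q4 L g f f f"
  proof -
    have "integral\<^sup>L ?P U = integral\<^sup>L time (\<lambda>r. integral\<^sup>L (torus L) (\<lambda>x. U (r, x)))"
      by (rule ps.integral_fst'[symmetric, OF dct(2)])
    also have "\<dots> = Q4 L g f f f"
      unfolding Q4_def set_lebesgue_integral_lebesgue_on
    \<comment> \<open>The chosen representatives are compared with \<open>solution\<close> at each
      fixed \<open>r\<close>, where they agree almost everywhere in \<open>x\<close>; the joint
      measurability used for Fubini is that of \<open>U\<close>.\<close>
    proof (rule Bochner_Integration.integral_cong[OF refl])
      fix r
      have ae: "AE x in torus L. schroedinger L r h x = u x" if "AE x in lebesgue. schroedinger L r h x = u x" for h u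
        using that by (subst AE_restrict_space_iff) (auto elim: eventually_mono)
      have [measurable]: "schroedinger L r f \<in> borel_measurable (torus L)" "schroedinger L r g \<in> borel_measurable (torus L)"
        using f.AE_schroedinger_eq_solution(1)[OF refl] g.AE_schroedinger_eq_solution(1)[OF refl]
        by (auto intro: torus_L2_measurable)
      show "integral\<^sup>L (torus L) (\<lambda>x. U (r, x)) = integral\<^sup>L (torus L) (\<lambda>x. cnj (schroedinger L r g x) *
         schroedinger L r f x * cnj (schroedinger L r f x) * schroedinger L r f x)"
      proof (rule integral_cong_AE)
        show "AE x in torus L. U (r, x) = cnj (schroedinger L r g x) *
         schroedinger L r f x * cnj (schroedinger L r f x) * schroedinger L r f x"
          using ae[OF f.AE_schroedinger_eq_solution(2)[OF refl]] ae[OF g.AE_schroedinger_eq_solution(2)[OF refl]]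
          by eventually_elim (simp add: U_def)
        show "(\<lambda>x. U (r, x)) \<in> borel_measurable (torus L)" unfolding U_def fst_conv snd_conv by measurable
      qed measurable
    qed
    finally show ?thesis .
  qed
  ultimately show ?thesis using that[OF N] dct(1) by simp
qed

section \<open>The maximal value and the Euler-Lagrange equation\<close>

lemma evolve_torus_L2:
  assumes L: "L > 0"
  shows "evolve L F a r \<in> torus_L2 L"
proof -
  have m: "(\<lambda>x. evolve L F a r x) \<in> borel_measurable M" if "(\<lambda>x::real. x) \<in> borel_measurable M" for M
    using that by (intro evolve_measurable) auto
  have "integrable (torus L) (\<lambda>x. (cmod (evolve L F a r x))\<^sup>2)"
  proof (rule finite_measure.integrable_const_bound[OF finite_measure_interval])
    show "AE x in torus L. norm ((cmod (evolve L F a r x))\<^sup>2) \<le> ((\<Sum>k\<in>F. cmod (a k)) / sqrt L)\<^sup>2"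
      using norm_evolve_le[OF L] by (intro AE_I2) (auto intro!: power_mono)
  qed (use m[OF borel_measurable_ident_lebesgue_on] in measurable)
  moreover have "evolve L F a r \<in> borel_measurable lebesgue"
    using m[of lebesgue] borel_measurable_ident_lebesgue_on[of UNIV] by (simp add: lebesgue_on_UNIV_eq)
  moreover have "periodic L (evolve L F a r)"
    by (simp add: periodic_def evolve_def mode_periodic[OF L])
  ultimately show ?thesis by (simp add: torus_L2_def set_integrable_lebesgue_on)
qed

lemma torus_fourier_evolve:
  assumes "L > 0" "finite F"
  shows "torus_fourier L (evolve L F a 0) k = (if k \<in> F then a k else 0)"
  unfolding torus_fourier_mode evolve_fourier[OF assms] by simp

lemma torus_norm_evolve:
  assumes "L > 0" "finite F"
  shows "torus_norm L (evolve L F a r) = sqrt (\<Sum>k\<in>F. (cmod (a k))\<^sup>2)"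
  unfolding torus_norm_eq evolve_L2[OF assms] by (rule refl)

text \<open>This makes the supremum in \<open>omega1\<close> one over a bounded set, so that test
  functions yield lower bounds for it.\<close>

lemma Q4_self_bound:
  assumes L: "L > 0" and f: "f \<in> torus_L2 L" and f1: "torus_norm L f = 1"
  shows "Re (Q4 L f f f f) \<le> strichartz_const L"
proof -
  obtain N where N: "(\<lambda>j. of_real (1 / L) * (\<Sum>k\<in>mode_range N j. cnj (torus_fourier L f k) *
      cubic L (mode_range N j) (torus_fourier L f) k)) \<longlonglongrightarrow> Q4 L f f f f" (is "?s \<longlonglongrightarrow> _")
    using Q4_limit[OF L f f] by blast
  have C0: "strichartz_const L \<ge> 0" using L by (simp add: strichartz_const_def)
  have "Re (?s j) \<le> strichartz_const L" for j
  proof -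
    have "(\<Sum>k\<in>mode_range N j. (cmod (torus_fourier L f k))\<^sup>2) \<le> 1"
      using bessel[OF L f finite_mode_range, of N j] torus_norm_square[of L f] f1 by simp
    then have "(\<Sum>k\<in>mode_range N j. (cmod (torus_fourier L f k))\<^sup>2)\<^sup>2 \<le> 1"
      by (intro power_le_one) (auto intro: sum_nonneg)
    then have "strichartz_const L * (\<Sum>k\<in>mode_range N j. (cmod (torus_fourier L f k))\<^sup>2)\<^sup>2 \<le> strichartz_const L"
      using C0 by (rule mult_left_le)
    then show ?thesis
      using strichartz_bound[OF L finite_mode_range[of N j], of "torus_fourier L f"] complex_Re_le_cmod[of "?s j"] by linarith
  qed
  then show ?thesis using tendsto_Re[OF N] by (intro LIMSEQ_le_const2) auto
qed

lemma Q4_le_omega1: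
  assumes L: "L > 0" and f: "f \<in> torus_L2 L" "torus_norm L f = 1"
  shows "Re (Q4 L f f f f) \<le> omega1 L"
  unfolding omega1_def
proof (rule cSUP_upper)
  show "bdd_above ((\<lambda>f. Re (Q4 L f f f f)) ` {f \<in> torus_L2 L. torus_norm L f = 1})"
    using Q4_self_bound[OF L] by (auto intro!: bdd_aboveI)
qed (use f in auto)

text \<open>The sums of \<open>Q4_limit\<close> are eventually constant: the coefficients vanish off
  \<open>F\<close>, so a larger range gives the same function, and \<open>evolve_quartic\<close>
  read backwards identifies the sums.\<close>

lemma Q4_evolve:
  assumes L: "L > 0" and F: "finite F" and a: "\<And>k. k \<notin> F \<Longrightarrow> a k = 0"
  shows "Q4 L (evolve L F a 0) (evolve L F a 0) (evolve L F a 0) (evolve L F a 0) =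
    of_real (1 / L) * (\<Sum>k\<in>F. cnj (a k) * cubic L F a k)"
proof -
  let ?f = "evolve L F a 0"
  have co: "torus_fourier L ?f = a" using torus_fourier_evolve[OF L F, of a] a by auto
  obtain N where N: "strict_mono N" "(\<lambda>j. of_real (1 / L) * (\<Sum>k\<in>mode_range N j. cnj (a k) *
      cubic L (mode_range N j) a k)) \<longlonglongrightarrow> Q4 L ?f ?f ?f ?f"
    using Q4_limit[OF L evolve_torus_L2[OF L] evolve_torus_L2[OF L], of F a 0 F a 0] unfolding co by blast
  have ev: "\<forall>\<^sub>F j in sequentially. F \<subseteq> mode_range N j"
  proof -
    have "\<forall>\<^sub>F j in sequentially. k \<in> mode_range N j" for k
      by (rule eventually_in_mode_range[OF N(1)])
    then have "\<forall>\<^sub>F j in sequentially. \<forall>k\<in>F. k \<in> mode_range N j"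
      by (intro eventually_ball_finite F) auto
    then show ?thesis by eventually_elim auto
  qed
  have "\<forall>\<^sub>F j in sequentially. of_real (1 / L) * (\<Sum>k\<in>mode_range N j. cnj (a k) * cubic L (mode_range N j) a k) =
      of_real (1 / L) * (\<Sum>k\<in>F. cnj (a k) * cubic L F a k)"
    using ev
  proof eventually_elim
    case (elim j)
    have "evolve L (mode_range N j) a = evolve L F a"
      unfolding evolve_def by (intro ext sum.mono_neutral_right) (use elim a in auto)
    then show ?case
      unfolding evolve_quartic[OF L F, of a a, symmetric]
        evolve_quartic[OF L finite_mode_range[of N j], of a a, symmetric] by simp
  qed
  then have "(\<lambda>j. of_real (1 / L) * (\<Sum>k\<in>mode_range N j. cnj (a k) * cubic L (mode_range N j) a k)) \<longlonglongrightarrow>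
      of_real (1 / L) * (\<Sum>k\<in>F. cnj (a k) * cubic L F a k)"
    by (rule tendsto_eventually)
  then show ?thesis using N(2) LIMSEQ_unique by blast
qed

text \<open>Of the 19 triples \<open>(k, l, m)\<close> with \<open>l + m - k\<close> in
  \<open>F\<close>, 15 are resonant and 4 are not, each weighing \<open>c^4 = 1/9\<close>. The
  resonant ones give only 15/9, so the other four are decisive.\<close>

lemma omega1_gt:
  assumes L: "L \<ge> 100"
  shows "omega1 L > 2 / L"
proof -
  have L0: "L > 0" using L by simp
  define F :: "int set" where "F = {-1, 0, 1}"
  define c :: real where "c = 1 / sqrt 3"
  define a where "a = (\<lambda>k. if k \<in> F then complex_of_real c else 0)"
  have F: "finite F" by (simp add: F_def)
  have c2: "c\<^sup>2 = 1 / 3" by (simp add: c_def power_divide)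
  have "c * c * c * c = c\<^sup>2 * c\<^sup>2" by (simp add: power2_eq_square)
  then have c4: "c * c * c * c = 1 / 9" unfolding c2 by simp
  let ?f = "evolve L F a 0"
  have n1: "torus_norm L ?f = 1"
    unfolding torus_norm_evolve[OF L0 F] by (simp add: a_def F_def c2)
  \<comment> \<open>With |(k - l) (k - m)| \<le> 4, pi < 4 and \<open>L \<ge> 100\<close> the phase
    integral is within 8 * 16 * 4 / 10000 = 0.0512 of 1, and 19/9 times 0.9488 still exceeds
    2.\<close>
  have Phi: "Re (phase_integral L ((k - l) * (k - m))) \<ge> 9488 / 10000" if "k \<in> F" "l \<in> F" "m \<in> F" for k l m
  proof -
    let ?n = "(k - l) * (k - m)"
    have n: "\<bar>real_of_int ?n\<bar> \<le> 4" using that by (auto simp: F_def)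
    have "pi\<^sup>2 \<le> 4\<^sup>2" using pi_less_4 by (intro power_mono) auto
    then have "8 * pi\<^sup>2 * \<bar>real_of_int ?n\<bar> \<le> 8 * 16 * 4" using n by (intro mult_mono) auto
    moreover have "L\<^sup>2 \<ge> 10000" using power_mono[OF L, of 2] by simp
    ultimately have "8 * pi\<^sup>2 * \<bar>real_of_int ?n\<bar> / L\<^sup>2 \<le> 512 / 10000"
      by (intro frac_le) auto
    then have "cmod (phase_integral L ?n - 1) \<le> 512 / 10000"
      using norm_phase_integral_diff_1[OF L0, of ?n] by linarith
    then show ?thesis using abs_Re_le_cmod[of "phase_integral L ?n - 1"] by simp
  qed
  have "(1 / 9) * (19 * (9488 / 10000)) = (\<Sum>k\<in>F. \<Sum>l\<in>F. \<Sum>m\<in>F. if l + m - k \<in> F then (1 / 9) * (9488 / 10000) else (0::real))"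
    by (simp add: F_def)
  also have "\<dots> \<le> (\<Sum>k\<in>F. \<Sum>l\<in>F. \<Sum>m\<in>F. if l + m - k \<in> F then (1 / 9) * Re (phase_integral L ((k - l) * (k - m))) else 0)"
    using Phi by (intro sum_mono) auto
  also have "\<dots> = Re (\<Sum>k\<in>F. cnj (a k) * cubic L F a k)"
    unfolding cubic_def Re_sum sum_distrib_left
  proof (intro sum.cong refl)
    fix k l m assume klm: "k \<in> F" "l \<in> F" "m \<in> F"
    have c4': "c * (c * (c * (c * z))) = (1 / 9) * z" for z unfolding c4[symmetric] by (simp only: mult.assoc)
    have re: "Re (of_real t * z) = t * Re z" for t z by simp
    show "(if l + m - k \<in> F then (1 / 9) * Re (phase_integral L ((k - l) * (k - m))) else 0) =
       Re (cnj (a k) * (if l + m - k \<in> F then a l * cnj (a (l + m - k)) * a m * phase_integral L ((k - l) * (k - m)) else 0))"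
    proof (cases "l + m - k \<in> F")
      case True
      then have "a k = of_real c" "a l = of_real c" "a m = of_real c" "a (l + m - k) = of_real c"
        using klm by (simp_all add: a_def)
      then show ?thesis using True by (simp only: if_True complex_cnj_complex_of_real mult.assoc re c4')
    qed simp
  qed
  finally have "2 < Re (\<Sum>k\<in>F. cnj (a k) * cubic L F a k)" by simp
  then have "2 / L < (1 / L) * Re (\<Sum>k\<in>F. cnj (a k) * cubic L F a k)"
    using L0 by (simp add: divide_strict_right_mono)
  also have "\<dots> = Re (Q4 L ?f ?f ?f ?f)"
  proof -
    have "Q4 L ?f ?f ?f ?f = of_real (1 / L) * (\<Sum>k\<in>F. cnj (a k) * cubic L F a k)"
      by (rule Q4_evolve[OF L0 F]) (simp add: a_def)
    moreover have "Re (of_real t * z) = t * Re z" for t z by simp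
    ultimately show ?thesis by (simp only:)
  qed
  also have "\<dots> \<le> omega1 L" by (rule Q4_le_omega1[OF L0 evolve_torus_L2[OF L0] n1])
  finally show ?thesis .
qed

section \<open>From the weak equation to an inequality for the Fourier modes\<close>

lemma trilinear_mono:
  assumes "F \<subseteq> F'" "finite F'" "\<And>k. 0 \<le> x k" "\<And>k. x k \<le> y k"
  shows "trilinear F recip_abs recip_abs x k \<le> trilinear F' recip_abs recip_abs y k"
proof -
  have y0: "0 \<le> y k" for k using assms(3,4)[of k] by linarith
  have "trilinear F recip_abs recip_abs x k \<le> trilinear F recip_abs recip_abs y k"
    unfolding trilinear_def
    by (intro sum_mono) (auto intro!: mult_left_mono mult_mono mult_nonneg_nonneg assms y0)
  also have "\<dots> \<le> trilinear F' recip_abs recip_abs y k"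
    unfolding trilinear_def
    by (intro sum_mono2) (use assms y0 in \<open>auto intro!: mult_nonneg_nonneg\<close>)
  finally show ?thesis .
qed

text \<open>Testing with the \<open>k\<close>-th mode isolates the \<open>k\<close>-th coefficient.
  The truncated mass \<open>S\<close> is at most 1 and |a k|^2 enters with the favourable sign, so
  the linear factor is at least \<open>L * \<omega> - 2\<close>. The error \<open>e\<close> pays for
  truncating the Fourier series.\<close>

lemma weak_solution_inequality:
  assumes L: "L > 0" and f: "f \<in> torus_L2 L" "torus_norm L f = 1" and ws: "weak_solution L \<omega> f" and e: "e > 0"
  shows "\<exists>n0::nat. \<forall>n\<ge>n0. (L * \<omega> - 2) * cmod (torus_fourier L f k) \<le>
     e + L\<^sup>2 / (4 * pi\<^sup>2) * trilinear {- int n..int n} recip_abs recip_abs (\<lambda>k. cmod (torus_fourier L f k)) k"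
proof -
  define a where "a = torus_fourier L f"
  let ?g = "evolve L {k} (\<lambda>_. 1) 0"
  have g: "?g \<in> torus_L2 L" by (rule evolve_torus_L2[OF L])
  have gf: "torus_fourier L ?g j = (if j = k then 1 else 0)" for j
    using torus_fourier_evolve[OF L, of "{k}" "\<lambda>_. 1" j] by simp
  have inner: "torus_inner L ?g f = a k"
    by (simp add: torus_inner_def set_lebesgue_integral_lebesgue_on evolve_def a_def torus_fourier_mode mult.commute)
  obtain N where N: "strict_mono N" and lim: "(\<lambda>j. of_real (1 / L) * (\<Sum>k'\<in>mode_range N j. cnj (torus_fourier L ?g k') *
      cubic L (mode_range N j) a k')) \<longlonglongrightarrow> Q4 L ?g f f f"
    using Q4_limit[OF L f(1) g] unfolding a_def by blast
  have "Q4 L ?g f f f = of_real \<omega> * a k" using bspec[OF ws[unfolded weak_solution_def] g] inner by simp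
  with lim have "\<forall>\<^sub>F j in sequentially. dist (of_real (1 / L) * (\<Sum>k'\<in>mode_range N j. cnj (torus_fourier L ?g k') *
      cubic L (mode_range N j) a k')) (of_real \<omega> * a k) < e / L"
    using e L by (intro tendstoD) auto
  moreover have "\<forall>\<^sub>F j in sequentially. k \<in> mode_range N j"
    by (rule eventually_in_mode_range[OF N])
  ultimately have "\<forall>\<^sub>F j in sequentially. k \<in> mode_range N j \<and> cmod (of_real (1 / L) * cubic L (mode_range N j) a k - of_real \<omega> * a k) < e / L"
  proof eventually_elim
    case (elim j)
    have "(\<Sum>k'\<in>mode_range N j. cnj (torus_fourier L ?g k') * cubic L (mode_range N j) a k') =
      (\<Sum>k'\<in>mode_range N j. if k' = k then cubic L (mode_range N j) a k else 0)"
      by (intro sum.cong) (auto simp: gf)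
    also have "\<dots> = cubic L (mode_range N j) a k" using elim by simp
    finally show ?case using elim by (simp add: dist_norm)
  qed
  then obtain j where j: "k \<in> mode_range N j" "cmod (of_real (1 / L) * cubic L (mode_range N j) a k - of_real \<omega> * a k) < e / L"
    using eventually_happens'[OF sequentially_bot] by blast
  define X where "X = cubic L (mode_range N j) a k"
  define S where "S = (\<Sum>l\<in>mode_range N j. (cmod (a l))\<^sup>2)"
  have "S \<le> 1" unfolding S_def a_def
    using bessel[OF L f(1) finite_mode_range, of N j] torus_norm_square[of L f] f(2) by simp
  have "cmod (X - of_real (L * \<omega>) * a k) < e"
  proof -
    have "of_real (1 / L) * X - of_real \<omega> * a k = of_real (1 / L) * (X - of_real (L * \<omega>) * a k)"
      using L by (simp add: field_simps)
    then have "cmod (X - of_real (L * \<omega>) * a k) / L < e / L"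
      using j(2) L by (simp add: X_def norm_mult norm_divide)
    then show ?thesis using L by (simp add: divide_less_cancel)
  qed
  moreover have "cmod (X - (2 * S - (cmod (a k))\<^sup>2) * a k) \<le> L\<^sup>2 / (4 * pi\<^sup>2) * trilinear (mode_range N j) recip_abs recip_abs (truncated_norm (mode_range N j) a) k"
    unfolding X_def S_def by (rule cubic_resonance[OF L finite_mode_range j(1)])
  moreover have "(L * \<omega> - 2) * cmod (a k) \<le> cmod (X - of_real (L * \<omega>) * a k) + cmod (X - (2 * S - (cmod (a k))\<^sup>2) * a k)"
  proof -
    have "(L * \<omega> - 2) * cmod (a k) \<le> \<bar>L * \<omega> - (2 * S - (cmod (a k))\<^sup>2)\<bar> * cmod (a k)"
    proof (rule mult_right_mono)
      have "L * \<omega> - 2 \<le> L * \<omega> - (2 * S - (cmod (a k))\<^sup>2)"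
        using \<open>S \<le> 1\<close> zero_le_power2[of "cmod (a k)"] by linarith
      then show "L * \<omega> - 2 \<le> \<bar>L * \<omega> - (2 * S - (cmod (a k))\<^sup>2)\<bar>" by linarith
    qed simp
    also have "\<dots> = cmod (of_real (L * \<omega> - (2 * S - (cmod (a k))\<^sup>2)) * a k)" by (simp only: norm_mult norm_of_real)
    also have "of_real (L * \<omega> - (2 * S - (cmod (a k))\<^sup>2)) * a k =
        (X - (2 * S - (cmod (a k))\<^sup>2) * a k) - (X - of_real (L * \<omega>) * a k)"
      by (simp add: algebra_simps)
    also have "cmod \<dots> \<le> cmod (X - (2 * S - (cmod (a k))\<^sup>2) * a k) + cmod (X - of_real (L * \<omega>) * a k)"
      by (rule norm_triangle_ineq4)
    finally show ?thesis by simp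
  qed
  ultimately have b: "(L * \<omega> - 2) * cmod (a k) \<le> e + L\<^sup>2 / (4 * pi\<^sup>2) * trilinear (mode_range N j) recip_abs recip_abs (truncated_norm (mode_range N j) a) k"
    by linarith
  \<comment> \<open>A single truncation level is enough: all terms of \<open>trilinear\<close> are
    nonnegative, so enlarging the range only raises the right-hand side.\<close>
  have "(L * \<omega> - 2) * cmod (a k) \<le> e + L\<^sup>2 / (4 * pi\<^sup>2) * trilinear {- int n..int n} recip_abs recip_abs (\<lambda>k. cmod (a k)) k" if "n \<ge> N j" for n
  proof -
    have "trilinear (mode_range N j) recip_abs recip_abs (truncated_norm (mode_range N j) a) k \<le> trilinear {- int n..int n} recip_abs recip_abs (\<lambda>k. cmod (a k)) k"
      by (rule trilinear_mono) (use that in \<open>auto simp: mode_range_def truncated_norm_def\<close>)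
    then have "L\<^sup>2 / (4 * pi\<^sup>2) * trilinear (mode_range N j) recip_abs recip_abs (truncated_norm (mode_range N j) a) k \<le>
       L\<^sup>2 / (4 * pi\<^sup>2) * trilinear {- int n..int n} recip_abs recip_abs (\<lambda>k. cmod (a k)) k"
      by (rule mult_left_mono) simp
    then show ?thesis using b by linarith
  qed
  then show ?thesis unfolding a_def by blast
qed

lemma fourier_exponential_decay:
  assumes L: "L \<ge> 100" and f: "f \<in> torus_L2 L" "torus_norm L f = 1" and ws: "weak_solution L (omega1 L) f"
  shows "\<exists>\<rho>>1. \<exists>B>0. \<forall>k. cmod (torus_fourier L f k) * \<rho> ^ nat \<bar>k\<bar> \<le> B"
proof -
  have L0: "L > 0" using L by simp
  show ?thesis
  proof (rule bootstrap_decay)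
    show "L * omega1 L - 2 > 0" using omega1_gt[OF L] L0 by (simp add: field_simps)
    show "L\<^sup>2 / (4 * pi\<^sup>2) > 0" using L0 by simp
    show "(\<Sum>k\<in>S. (cmod (torus_fourier L f k))\<^sup>2) \<le> 1" if "finite S" for S
      using bessel[OF L0 f(1) that] torus_norm_square[of L f] f(2) by simp
  qed (use weak_solution_inequality[OF L0 f ws] in auto)
qed

section \<open>Analyticity\<close>

lemma sum_symmetric_interval:
  fixes g :: "int \<Rightarrow> 'a::ab_group_add"
  shows "(\<Sum>k\<in>{- int n..int n}. g k) = (\<Sum>i\<le>n. g (int i)) + (\<Sum>i\<le>n. g (- int i)) - g 0"
proof (induction n)
  case (Suc n)
  have "{- int (Suc n)..int (Suc n)} = {- int n..int n} \<union> {int (Suc n), - int (Suc n)}" by auto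
  then have "(\<Sum>k\<in>{- int (Suc n)..int (Suc n)}. g k) = (\<Sum>k\<in>{- int n..int n}. g k) + (\<Sum>k\<in>{int (Suc n), - int (Suc n)}. g k)"
    by (simp only:) (rule sum.union_disjoint, auto)
  then show ?case using Suc by (simp add: algebra_simps)
qed simp

lemma geometric_power_series_sums:
  fixes b :: "nat \<Rightarrow> complex"
  assumes \<rho>: "\<rho> > 0" and b: "\<And>n. cmod (b n) * \<rho> ^ n \<le> B" and w: "cmod w < \<rho>"
  shows "(\<lambda>n. b n * w ^ n) sums (\<Sum>n. b n * w ^ n)"
proof (rule summable_sums, rule summable_comparison_test'[of "\<lambda>n. B * (cmod w / \<rho>) ^ n" 0])
  show "summable (\<lambda>n. B * (cmod w / \<rho>) ^ n)"
    by (intro summable_mult summable_geometric) (use \<rho> w in auto)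
  fix n
  have "norm (b n * w ^ n) = (cmod (b n) * \<rho> ^ n) * (cmod w / \<rho>) ^ n"
    using \<rho> by (simp add: norm_mult norm_power power_divide)
  also have "\<dots> \<le> B * (cmod w / \<rho>) ^ n" using \<rho> by (intro mult_right_mono b) auto
  finally show "norm (b n * w ^ n) \<le> B * (cmod w / \<rho>) ^ n" .
qed

text \<open>The Fourier series splits into a power series in \<open>E z\<close> and one in
  \<open>E (- z)\<close>, both convergent in the disc of radius \<rho>. A strip around the real axis
  is mapped into that disc, so the sum extends holomorphically and has Taylor series at real
  points.\<close>

lemma exponential_decay_real_analytic:
  fixes a :: "int \<Rightarrow> complex"
  assumes L: "L > 0" and \<rho>: "\<rho> > 1" and a: "\<And>k. cmod (a k) * \<rho> ^ nat \<bar>k\<bar> \<le> B"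
  obtains h where "real_analytic h" "periodic L h"
    "\<And>x. (\<lambda>n. evolve L {- int n..int n} a 0 x) \<longlonglongrightarrow> h x"
proof -
  define s where "s = complex_of_real (1 / sqrt L)"
  define bp bm where "bp = (\<lambda>n. s * a (int n))" and "bm = (\<lambda>n. s * a (- int n))"
  define P M where "P = (\<lambda>w. \<Sum>n. bp n * w ^ n)" and "M = (\<lambda>w. \<Sum>n. bm n * w ^ n)"
  have bb: "cmod (bp n) * \<rho> ^ n \<le> cmod s * B" "cmod (bm n) * \<rho> ^ n \<le> cmod s * B" for n
    using mult_left_mono[OF a[of "int n"], of "cmod s"] mult_left_mono[OF a[of "- int n"], of "cmod s"]
    by (auto simp: bp_def bm_def norm_mult mult.assoc)
  have Ps: "(\<lambda>n. bp n * w ^ n) sums P w" and Ms: "(\<lambda>n. bm n * w ^ n) sums M w" if "cmod w < \<rho>" for w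
    unfolding P_def M_def
    by (rule geometric_power_series_sums[of \<rho> _ "cmod s * B"]; use bb that \<rho> in auto)+
  have Ph: "P holomorphic_on ball 0 \<rho>"
    by (rule power_series_holomorphic[of _ _ bp]) (use Ps in auto)
  have Mh: "M holomorphic_on ball 0 \<rho>"
    by (rule power_series_holomorphic[of _ _ bm]) (use Ms in auto)
  define E where "E = (\<lambda>z. exp (\<i> * of_real (2 * pi / L) * z))"
  \<comment> \<open>Frequency 0 occurs in both power series and is subtracted once.\<close>
  define H where "H = (\<lambda>z. P (E z) + M (E (- z)) - s * a 0)"
  \<comment> \<open>Since |E z| = exp (- 2 pi Im z / L), this is the half-width of the strip on
    which \<open>E z\<close> and \<open>E (- z)\<close> stay below \<rho> in modulus.\<close>
  define r where "r = ln \<rho> * L / (2 * pi)"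
  have r: "r > 0" using \<rho> L by (simp add: r_def)
  have Eb: "E z \<in> ball 0 \<rho>" if "\<bar>Im z\<bar> < r" for z
  proof -
    have "cmod (E z) = exp (- (2 * pi / L * Im z))" by (simp add: E_def)
    also have "\<dots> < exp (ln \<rho>)"
    proof -
      have "2 * pi / L * (- Im z) < 2 * pi / L * r" using that L by (intro mult_strict_left_mono) auto
      also have "\<dots> = ln \<rho>" using L by (simp add: r_def)
      finally show ?thesis by simp
    qed
    finally show ?thesis using \<rho> by simp
  qed
  have Eh: "E holomorphic_on A" "(\<lambda>z. E (- z)) holomorphic_on A" for A
    unfolding E_def by (intro holomorphic_intros)+
  have Hh: "H holomorphic_on ball (of_real x0) r" for x0 :: real
  proof -
    have im: "\<bar>Im z\<bar> < r" if "z \<in> ball (of_real x0) r" for z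
      using that abs_Im_le_cmod[of "z - of_real x0"] by (simp add: dist_norm norm_minus_commute)
    have "(P \<circ> E) holomorphic_on ball (of_real x0) r"
      by (rule holomorphic_on_compose_gen[OF Eh(1) Ph]) (use Eb im in auto)
    moreover have "(M \<circ> (\<lambda>z. E (- z))) holomorphic_on ball (of_real x0) r"
    proof (rule holomorphic_on_compose_gen[OF Eh(2) Mh])
      show "(\<lambda>z. E (- z)) ` ball (of_real x0) r \<subseteq> ball 0 \<rho>"
        using Eb[of "- _"] im by (auto simp del: mem_ball)
    qed
    ultimately show ?thesis unfolding H_def o_def by (intro holomorphic_intros)
  qed
  define h where "h = (\<lambda>x. H (complex_of_real x))"
  show ?thesis
  proof (rule that[of h])
    show "real_analytic h" unfolding real_analytic_def
    proof (intro allI exI conjI impI)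
      fix x0 x :: real
      show "r > 0" by (rule r)
      assume "\<bar>x - x0\<bar> < r"
      then have "complex_of_real x \<in> ball (of_real x0) r"
        by (simp add: dist_norm abs_minus_commute flip: of_real_diff)
      from holomorphic_power_series[OF Hh this]
      show "(\<lambda>n. ((deriv ^^ n) H (of_real x0) / fact n) * complex_of_real (x - x0) ^ n) sums h x"
        by (simp add: h_def)
    qed
    show "periodic L h"
    proof -
      have "E (of_real (x + L)) = E (of_real x)" "E (- of_real (x + L)) = E (- of_real x)" for x
      proof -
        have e: "\<i> * of_real (2 * pi / L) * of_real (x + L) = \<i> * of_real (2 * pi / L) * of_real x + 2 * of_real pi * \<i>"
          using L by (simp add: field_simps)
        have e2: "\<i> * of_real (2 * pi / L) * - of_real (x + L) = \<i> * of_real (2 * pi / L) * - of_real x - 2 * of_real pi * \<i>"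
          unfolding mult_minus_right e by simp
        show "E (of_real (x + L)) = E (of_real x)" "E (- of_real (x + L)) = E (- of_real x)"
          unfolding E_def e e2 by (simp_all only: exp_add exp_diff exp_two_pi_i mult_1_right div_by_1)
      qed
      then show ?thesis by (simp add: periodic_def h_def H_def)
    qed
    fix x
    have Er: "E (of_real x) = cis (2 * pi * x / L)" "E (- of_real x) = cis (- (2 * pi * x / L))"
      by (simp_all add: E_def cis_conv_exp mult.assoc)
    have lt: "cmod (E (of_real x)) < \<rho>" "cmod (E (- of_real x)) < \<rho>" using \<rho> unfolding Er by auto
    have pos: "mode L (int i) 0 x = s * cis (2 * pi * x / L) ^ i" for i
      unfolding Complex.DeMoivre mode_def s_def by (simp add: mult_ac)
    have neg: "mode L (- int i) 0 x = s * cis (- (2 * pi * x / L)) ^ i" for i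
      unfolding Complex.DeMoivre mode_def s_def by (simp add: mult_ac)
    have "evolve L {- int n..int n} a 0 x =
        (\<Sum>i\<le>n. bp i * E (of_real x) ^ i) + (\<Sum>i\<le>n. bm i * E (- of_real x) ^ i) - s * a 0" for n
      unfolding evolve_def sum_symmetric_interval Er
      unfolding pos neg bp_def bm_def by (simp add: mult_ac mode_def s_def)
    moreover have "(\<lambda>n. (\<Sum>i\<le>n. bp i * E (of_real x) ^ i) + (\<Sum>i\<le>n. bm i * E (- of_real x) ^ i) - s * a 0) \<longlonglongrightarrow> h x"
      unfolding h_def H_def using Ps[OF lt(1)] Ms[OF lt(2)] unfolding sums_def_le
      by (intro tendsto_intros)
    ultimately show "(\<lambda>n. evolve L {- int n..int n} a 0 x) \<longlonglongrightarrow> h x" by simp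
  qed
qed

text \<open>Convergence at every point passes to the sparse subsequence that defines
  \<open>solution 0\<close>, so this function is \<open>h\<close>; having the coefficients of
  \<open>f\<close>, it equals \<open>f\<close> almost everywhere.\<close>

lemma AE_eq_of_partial_sums:
  assumes L: "L > 0" and f: "f \<in> torus_L2 L"
    and lim: "\<And>x. (\<lambda>n. evolve L {- int n..int n} (torus_fourier L f) 0 x) \<longlonglongrightarrow> h x"
  shows "AE x in lebesgue. f x = h x"
proof -
  obtain N K where N: "strict_mono N" and K: "\<And>i. (\<Sum>k\<in>mode_block N i. (cmod (torus_fourier L f k))\<^sup>2) \<le> K / 4 ^ i"
    using rapid_blocks_exist[of "\<lambda>k. (cmod (torus_fourier L f k))\<^sup>2", OF _ bessel[OF L f]] by auto
  interpret rapid_blocks L "torus_fourier L f" N K by unfold_locales (use L N K in auto)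
  have "solution 0 x = h x" for x
    using LIMSEQ_subseq_LIMSEQ[OF lim N, of x] unfolding solution_def partial_def mode_range_def o_def
    by (rule limI)
  moreover have "AE x in lebesgue. f x = solution 0 x"
    by (rule torus_fourier_unique[OF L f solution_in_torus_L2]) (simp add: solution_fourier)
  ultimately show ?thesis by simp
qed

theorem theorem1p3:
  "\<exists>L0::real. L0 > 0 \<and> (\<forall>L\<ge>L0. \<forall>f :: real \<Rightarrow> complex.
     f \<in> torus_L2 L \<and> torus_norm L f = 1 \<and> weak_solution L (omega1 L) f \<longrightarrow>
       (\<exists>c>0. \<exists>C>0. \<forall>k::int.
          cmod (torus_fourier L f k) \<le> C * exp (- c * real_of_int \<bar>k\<bar>)) \<and>
       (\<exists>h. real_analytic h \<and> periodic L h \<and> (AE x in lebesgue. f x = h x)))"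
\<comment> \<open>100 is the threshold from \<open>omega1_gt\<close>, above which the linear factor
  \<open>L * omega1 L - 2\<close> is positive.\<close>
proof (rule exI[of _ 100], intro conjI allI impI)
  fix L :: real and f :: "real \<Rightarrow> complex"
  assume L: "100 \<le> L" and "f \<in> torus_L2 L \<and> torus_norm L f = 1 \<and> weak_solution L (omega1 L) f"
  then have f: "f \<in> torus_L2 L" "torus_norm L f = 1" "weak_solution L (omega1 L) f" by auto
  have L0: "L > 0" using L by simp
  obtain \<rho> B where \<rho>: "\<rho> > 1" and B: "B > 0"
    and decay: "\<And>k. cmod (torus_fourier L f k) * \<rho> ^ nat \<bar>k\<bar> \<le> B"
    using fourier_exponential_decay[OF L f] by blast
  show "\<exists>c>0. \<exists>C>0. \<forall>k::int. cmod (torus_fourier L f k) \<le> C * exp (- c * real_of_int \<bar>k\<bar>)"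
  proof (rule exI[of _ "ln \<rho>"], intro exI[of _ B] conjI allI)
    show "ln \<rho> > 0" using \<rho> by simp
    fix k :: int
    have "exp (ln \<rho> * real_of_int \<bar>k\<bar>) = \<rho> ^ nat \<bar>k\<bar>"
      using \<rho> exp_of_nat_mult[of "nat \<bar>k\<bar>" "ln \<rho>"] by (simp add: mult.commute)
    then have e: "exp (- ln \<rho> * real_of_int \<bar>k\<bar>) = 1 / \<rho> ^ nat \<bar>k\<bar>"
      by (simp add: exp_minus inverse_eq_divide)
    have "\<rho> ^ nat \<bar>k\<bar> > 0" using \<rho> by simp
    then have "cmod (torus_fourier L f k) \<le> B * (1 / \<rho> ^ nat \<bar>k\<bar>)"
      using decay[of k] by (simp add: pos_le_divide_eq)
    then show "cmod (torus_fourier L f k) \<le> B * exp (- ln \<rho> * real_of_int \<bar>k\<bar>)"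
      unfolding e .
  qed (rule B)
  show "\<exists>h. real_analytic h \<and> periodic L h \<and> (AE x in lebesgue. f x = h x)"
    using exponential_decay_real_analytic[OF L0 \<rho> decay] AE_eq_of_partial_sums[OF L0 f(1)] by metis
qed simp

end
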